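(* For every constant $s\ge 1$, the Odd Cycle Transversal problem and the Connected Odd Cycle Transversal problem can both be solved in polynomial time on $sP_2$-free graphs.
   Context: All graphs are finite and simple. $P_2$ denotes the path on two vertices and $sP_2$ the disjoint union of $s$ copies of $P_2$. A graph is $sP_2$-free if it has no induced subgraph isomorphic to $sP_2$. An odd cycle transversal of a graph $G$ is a set $S\subseteq V(G)$ such that $G-S$ is bipartite; it is connected if the induced subgraph $G[S]$ is connected. Odd Cycle Transversal: given a graph $G$ and an integer $k$, decide whether $G$ has an odd cycle transversal of size at most $k$. Connected Odd Cycle Transversal: given $G$ and $k$, decide whether $G$ has a connected odd cycle transversal of size at most $k$. *)

theory Defs
  imports "Graph_Theory.Graph_Theory" "HOL-Computational_Algebra.Polynomial"
begin

section \<open>Graphs\<close>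

text \<open>
  A finite simple graph is a finite, symmetric, loop-free digraph without parallel arcs, i.e. a
  \<^term>\<open>G :: 'a pair_pre_digraph\<close> satisfying the library predicate \<^const>\<open>pair_graph\<close>; an edge
  \<open>uv\<close> is the pair of arcs \<open>(u, v)\<close> and \<open>(v, u)\<close>.
\<close>

definition path_graph :: "nat \<Rightarrow> nat pair_pre_digraph" where
  "path_graph n = \<lparr> pverts = {0..<n},
     parcs = {(i, j). i < n \<and> j < n \<and> (j = Suc i \<or> i = Suc j)} \<rparr>"

definition disjoint_copies :: "nat \<Rightarrow> 'a pair_pre_digraph \<Rightarrow> (nat \<times> 'a) pair_pre_digraph" where
  "disjoint_copies s F = \<lparr> pverts = {0..<s} \<times> pverts F,
     parcs = {((i, u), (j, v)). i < s \<and> i = j \<and> (u, v) \<in> parcs F} \<rparr>"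

definition induced_free :: "'f pair_pre_digraph \<Rightarrow> 'a pair_pre_digraph \<Rightarrow> bool" where
  "induced_free F G \<longleftrightarrow>
     \<not> (\<exists>H. induced_subgraph H (with_proj G) \<and> digraph_iso (with_proj F) H)"

definition bipartite :: "('a, 'b) pre_digraph \<Rightarrow> bool" where
  "bipartite G \<longleftrightarrow> (\<exists>A B. verts G = A \<union> B \<and> A \<inter> B = {} \<and>
     (\<forall>e \<in> arcs G. (tail G e \<in> A \<and> head G e \<in> B) \<or> (tail G e \<in> B \<and> head G e \<in> A)))"

definition odd_cycle_transversal :: "'a pair_pre_digraph \<Rightarrow> 'a set \<Rightarrow> bool" where
  "odd_cycle_transversal G S \<longleftrightarrow>
     S \<subseteq> pverts G \<and> bipartite (with_proj G \<restriction> (pverts G - S))"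

text \<open>
  The library predicate \<^const>\<open>connected\<close> is false for the graph without vertices. Here the empty
  graph counts as connected, so the empty set is a connected odd cycle transversal of every
  bipartite graph.
\<close>

definition connected_odd_cycle_transversal :: "'a pair_pre_digraph \<Rightarrow> 'a set \<Rightarrow> bool" where
  "connected_odd_cycle_transversal G S \<longleftrightarrow>
     odd_cycle_transversal G S \<and> (S = {} \<or> connected (with_proj G \<restriction> S))"


section \<open>Polynomial-time computation\<close>

text \<open>
  The machine model is the unit-cost random access machine with addition and truncated subtraction
  as its only arithmetic operations, programmed with structured control flow. A program uses
  registers and arrays, both named by numerals occurring in the program text, so any one program
  uses finitely many of them; array cells are addressed indirectly and hold natural numbers.

  Since there is no multiplication, a value computed in \<open>t\<close> steps has \<open>O(t)\<close> bits (plus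
  those of the largest initial value). Hence this cost measure is polynomially related to the
  logarithmic-cost one and to time on Turing machines. An expression in a fixed program has bounded
  size, so charging one unit for a command together with the expressions in it affects running
  times by a constant factor only.
\<close>

datatype aexp =
    Num nat
  | Reg nat
  | Get nat aexp  \<comment> \<open>\<open>Get a e\<close> is the content of array \<open>a\<close> at index \<open>e\<close>\<close>
  | Plus aexp aexp
  | Minus aexp aexp

datatype bexp = Less aexp aexp | Neg bexp | Conj bexp bexp

datatype com =
    Skip
  | Assign nat aexp
  | Store nat aexp aexp  \<comment> \<open>\<open>Store a i e\<close> sets array \<open>a\<close> at index \<open>i\<close> to \<open>e\<close>\<close>
  | Seq com com
  | If bexp com com
  | While bexp com

type_synonym state = "(nat \<Rightarrow> nat) \<times> (nat \<Rightarrow> nat \<Rightarrow> nat)"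

fun aval :: "aexp \<Rightarrow> state \<Rightarrow> nat" where
  "aval (Num n) \<sigma> = n"
| "aval (Reg x) \<sigma> = fst \<sigma> x"
| "aval (Get a e) \<sigma> = snd \<sigma> a (aval e \<sigma>)"
| "aval (Plus e1 e2) \<sigma> = aval e1 \<sigma> + aval e2 \<sigma>"
| "aval (Minus e1 e2) \<sigma> = aval e1 \<sigma> - aval e2 \<sigma>"

fun bval :: "bexp \<Rightarrow> state \<Rightarrow> bool" where
  "bval (Less e1 e2) \<sigma> \<longleftrightarrow> aval e1 \<sigma> < aval e2 \<sigma>"
| "bval (Neg b) \<sigma> \<longleftrightarrow> \<not> bval b \<sigma>"
| "bval (Conj b1 b2) \<sigma> \<longleftrightarrow> bval b1 \<sigma> \<and> bval b2 \<sigma>"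

text \<open>\<open>exec c \<sigma> t \<tau>\<close>: started in \<open>\<sigma>\<close>, the program \<open>c\<close> halts after exactly \<open>t\<close> steps in \<open>\<tau>\<close>.\<close>

inductive exec :: "com \<Rightarrow> state \<Rightarrow> nat \<Rightarrow> state \<Rightarrow> bool" where
  Skip: "exec Skip \<sigma> 1 \<sigma>"
| Assign: "exec (Assign x e) \<sigma> 1 ((fst \<sigma>)(x := aval e \<sigma>), snd \<sigma>)"
| Store: "exec (Store a i e) \<sigma> 1
    (fst \<sigma>, (snd \<sigma>)(a := (snd \<sigma> a)(aval i \<sigma> := aval e \<sigma>)))"
| Seq: "exec c1 \<sigma>1 t1 \<sigma>2 \<Longrightarrow> exec c2 \<sigma>2 t2 \<sigma>3 \<Longrightarrow> exec (Seq c1 c2) \<sigma>1 (t1 + t2) \<sigma>3"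
| IfTrue: "bval b \<sigma> \<Longrightarrow> exec c1 \<sigma> t \<tau> \<Longrightarrow> exec (If b c1 c2) \<sigma> (1 + t) \<tau>"
| IfFalse: "\<not> bval b \<sigma> \<Longrightarrow> exec c2 \<sigma> t \<tau> \<Longrightarrow> exec (If b c1 c2) \<sigma> (1 + t) \<tau>"
| WhileFalse: "\<not> bval b \<sigma> \<Longrightarrow> exec (While b c) \<sigma> 1 \<sigma>"
| WhileTrue: "bval b \<sigma>1 \<Longrightarrow> exec c \<sigma>1 t1 \<sigma>2 \<Longrightarrow> exec (While b c) \<sigma>2 t2 \<sigma>3 \<Longrightarrow>
    exec (While b c) \<sigma>1 (1 + t1 + t2) \<sigma>3"

inductive_cases exec_SkipE: "exec Skip \<sigma> t \<tau>"
inductive_cases exec_AssignE: "exec (Assign x e) \<sigma> t \<tau>"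
inductive_cases exec_StoreE: "exec (Store a i e) \<sigma> t \<tau>"
inductive_cases exec_SeqE: "exec (Seq c1 c2) \<sigma> t \<tau>"
inductive_cases exec_IfE: "exec (If b c1 c2) \<sigma> t \<tau>"
inductive_cases exec_WhileE: "exec (While b c) \<sigma> t \<tau>"

lemma exec_deterministic:
  assumes "exec c \<sigma> t \<tau>" and "exec c \<sigma> t' \<tau>'"
  shows "t = t' \<and> \<tau> = \<tau>'"
  using assms
proof (induction arbitrary: t' \<tau>' rule: exec.induct)
  case (Seq c1 \<sigma>1 t1 \<sigma>2 c2 t2 \<sigma>3)
  from Seq.prems obtain u1 \<rho> u2
    where "t' = u1 + u2" "exec c1 \<sigma>1 u1 \<rho>" "exec c2 \<rho> u2 \<tau>'"
    by (auto elim: exec_SeqE)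
  then show ?case using Seq.IH by blast
next
  case (IfTrue b \<sigma> c1 t \<tau> c2)
  from IfTrue.prems IfTrue.hyps(1) obtain u where "t' = 1 + u" "exec c1 \<sigma> u \<tau>'"
    by (auto elim: exec_IfE)
  then show ?case using IfTrue.IH by blast
next
  case (IfFalse b \<sigma> c2 t \<tau> c1)
  from IfFalse.prems IfFalse.hyps(1) obtain u where "t' = 1 + u" "exec c2 \<sigma> u \<tau>'"
    by (auto elim: exec_IfE)
  then show ?case using IfFalse.IH by blast
next
  case (WhileFalse b \<sigma> c)
  from WhileFalse.prems WhileFalse.hyps show ?case by (auto elim: exec_WhileE)
next
  case (WhileTrue b \<sigma>1 c t1 \<sigma>2 t2 \<sigma>3)
  from WhileTrue.prems WhileTrue.hyps(1) obtain u1 \<rho> u2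
    where "t' = 1 + u1 + u2" "exec c \<sigma>1 u1 \<rho>" "exec (While b c) \<rho> u2 \<tau>'"
    by (auto elim: exec_WhileE)
  then show ?case using WhileTrue.IH by blast
qed (auto elim: exec_SkipE exec_AssignE exec_StoreE)

text \<open>
  The input, a bit string, is placed in array \<open>0\<close> and its length in register \<open>0\<close>; all other
  registers and cells are \<open>0\<close>. The answer is read off register \<open>0\<close>.
\<close>

definition init_state :: "bool list \<Rightarrow> state" where
  "init_state w = ((\<lambda>x. 0)(0 := length w),
     (\<lambda>a i. 0)(0 := (\<lambda>i. if i < length w \<and> w ! i then 1 else 0)))"

text \<open>
  \<open>solvable_in_poly_time enc D Y\<close>: the decision problem with yes-instances \<open>Y\<close>, restricted to
  the instances in \<open>D\<close>, is solvable in time polynomial in the length of the encoding. Nothing is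
  required of the program on inputs that do not encode an element of \<open>D\<close>.
\<close>

definition solvable_in_poly_time :: "('i \<Rightarrow> bool list) \<Rightarrow> 'i set \<Rightarrow> 'i set \<Rightarrow> bool" where
  "solvable_in_poly_time enc D Y \<longleftrightarrow>
     (\<exists>(c :: com) (p :: nat poly). \<forall>x \<in> D. \<exists>t \<tau>.
        exec c (init_state (enc x)) t \<tau> \<and> t \<le> poly p (length (enc x)) \<and>
        fst \<tau> 0 = (if x \<in> Y then 1 else 0))"


section \<open>The two decision problems\<close>

text \<open>An instance is a finite simple graph, with natural numbers as vertices, and an integer.\<close>

type_synonym graph_instance = "nat pair_pre_digraph \<times> int"

definition odd_cycle_transversal_problem :: "graph_instance set" where
  "odd_cycle_transversal_problem =
     {(G, k). \<exists>S. odd_cycle_transversal G S \<and> int (card S) \<le> k}"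

definition connected_odd_cycle_transversal_problem :: "graph_instance set" where
  "connected_odd_cycle_transversal_problem =
     {(G, k). \<exists>S. connected_odd_cycle_transversal G S \<and> int (card S) \<le> k}"

definition free_instances :: "'f pair_pre_digraph \<Rightarrow> graph_instance set" where
  "free_instances F = {(G, k). pair_graph G \<and> induced_free F G}"

text \<open>Binary representation, least significant bit first.\<close>

fun binary :: "nat \<Rightarrow> bool list" where
  "binary n = (if n = 0 then [] else odd n # binary (n div 2))"

declare binary.simps [simp del]

text \<open>
  The number of vertices in unary, terminated by \<^const>\<open>False\<close>; the adjacency matrix row by row,
  with the vertices in increasing order; the sign of \<open>k\<close>; and the binary representation of its
  absolute value. The actual names of the vertices are not part of the input.
\<close>

definition encode :: "graph_instance \<Rightarrow> bool list" where
  "encode = (\<lambda>(G, k).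
     let vs = sorted_list_of_set (pverts G) in
       replicate (length vs) True @ [False]
       @ concat (map (\<lambda>u. map (\<lambda>v. (u, v) \<in> parcs G) vs) vs)
       @ [k < 0] @ binary (nat \<bar>k\<bar>))"

end

theory Submission
  imports Defs
begin

text \<open>
  In an \<open>sP\<^sub>2\<close>-free graph every maximal independent set is the result of a greedy procedure
  steered by fewer than \<open>s\<close> pairs of vertices. A minimal odd cycle transversal is the complement of
  the union of two maximal independent sets \<open>A\<close> and \<open>B\<close>, so running through all tuples of vertices
  finds a smallest one. For the connected variant, any transversal inside a component extends to a
  connected one by a number of vertices bounded in terms of \<open>s\<close>; hence a smallest connected
  transversal consists of the complement of some \<open>A \<union> B\<close> and boundedly many further vertices, which
  are added to the tuple. Connectivity is tested by walks of length at most \<open>3s\<close>, since shortest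
  paths are induced.

  On the machine side, the algorithm is a formula in a small language with bounded quantifiers,
  array comprehension and bounded iteration, every formula of which compiles to a polynomial-time
  program.
\<close>

section \<open>A language of polynomial-time formulas\<close>

text \<open>A departure from the greedy choice is witnessed by an edge \<open>vu\<close> such that
  the part of the independent set below \<open>v\<close> lies among the common non-neighbours of
  \<open>u\<close> and \<open>v\<close>. Restricting to these lowers the possible size of an induced
  matching by one, so fewer than \<open>s\<close> departures occur. This recovers the theorem of
  Balas and Yu that such graphs have only polynomially many maximal independent sets. The obstacle
  in the connected case is that a smallest connected transversal need not be the complement of a
  union of two such sets. It does contain such a complement, and comparing it with a cheap connected
  extension of that complement bounds the surplus by \<open>connector_bound s\<close>, so the
  surplus can be guessed as well. The tuple is thus a certificate whose length depends on
  \<open>s\<close> alone. What it describes is checked directly; the structure theory is needed only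
  to show that a good tuple exists. The formula language separates program verification from
  combinatorics: loops are verified once, in \<open>compile_runs\<close>.\<close>

text \<open>
  Variables are named by their binding depth: a binder at level \<open>d\<close> binds register \<open>d\<close> (or array
  \<open>d\<close>), register \<open>0\<close> holds the input length and register \<open>1\<close> the truth value computed last. All
  iterations are cut off at the input length, so every formula is decided in polynomial time.
\<close>

datatype fm =
    FLess aexp aexp
  | FNot fm
  | FAnd fm fm
  | FEx aexp fm
  | FFill aexp fm fm
  | FIter aexp aexp aexp fm

definition set_reg :: "nat \<Rightarrow> nat \<Rightarrow> state \<Rightarrow> state" where
  "set_reg x v \<sigma> = ((fst \<sigma>)(x := v), snd \<sigma>)"

definition set_arr :: "nat \<Rightarrow> (nat \<Rightarrow> nat) \<Rightarrow> state \<Rightarrow> state" where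
  "set_arr a f \<sigma> = (fst \<sigma>, (snd \<sigma>)(a := f))"

lemma set_reg_simps [simp]:
  "fst (set_reg x v \<sigma>) = (fst \<sigma>)(x := v)" "snd (set_reg x v \<sigma>) = snd \<sigma>"
  by (simp_all add: set_reg_def)

lemma set_arr_simps [simp]:
  "fst (set_arr a f \<sigma>) = fst \<sigma>" "snd (set_arr a f \<sigma>) = (snd \<sigma>)(a := f)"
  by (simp_all add: set_arr_def)

text \<open>\<open>P\<close> sees the cells already filled, so membership can be decided by
  course-of-values recursion along the vertex order, as a greedy choice requires.\<close>

primrec fill :: "(nat \<Rightarrow> (nat \<Rightarrow> nat) \<Rightarrow> bool) \<Rightarrow> nat \<Rightarrow> nat \<Rightarrow> nat" where
  "fill P 0 = (\<lambda>_. 0)"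
| "fill P (Suc m) = (fill P m)(m := of_bool (P m (fill P m)))"

primrec iterate :: "(nat \<Rightarrow> 'a \<Rightarrow> 'a) \<Rightarrow> 'a \<Rightarrow> nat \<Rightarrow> 'a" where
  "iterate f a 0 = a"
| "iterate f a (Suc m) = f m (iterate f a m)"

definition bound :: "aexp \<Rightarrow> state \<Rightarrow> nat" where
  "bound e \<sigma> = min (aval e \<sigma>) (fst \<sigma> 0)"

text \<open>
  In \<open>FFill e \<phi> \<psi>\<close> the formula \<open>\<phi>\<close> may inspect the part of the array already filled; in
  \<open>FIter e a f \<psi>\<close> the expression \<open>f\<close> reads its accumulator from register \<open>d\<close> and the loop counter
  from register \<open>d + 1\<close>.
\<close>

primrec fval :: "fm \<Rightarrow> nat \<Rightarrow> state \<Rightarrow> bool" where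
  "fval (FLess a b) d \<sigma> \<longleftrightarrow> aval a \<sigma> < aval b \<sigma>"
| "fval (FNot \<phi>) d \<sigma> \<longleftrightarrow> \<not> fval \<phi> d \<sigma>"
| "fval (FAnd \<phi> \<psi>) d \<sigma> \<longleftrightarrow> fval \<phi> d \<sigma> \<and> fval \<psi> d \<sigma>"
| "fval (FEx e \<phi>) d \<sigma> \<longleftrightarrow> (\<exists>i < bound e \<sigma>. fval \<phi> (Suc d) (set_reg d i \<sigma>))"
| "fval (FFill e \<phi> \<psi>) d \<sigma> \<longleftrightarrow> fval \<psi> (Suc d) (set_arr d
     (fill (\<lambda>v f. fval \<phi> (Suc d) (set_reg d v (set_arr d f \<sigma>))) (bound e \<sigma>)) (set_reg d 0 \<sigma>))"
| "fval (FIter e a f \<psi>) d \<sigma> \<longleftrightarrow> fval \<psi> (Suc d) (set_reg d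
     (iterate (\<lambda>m x. aval f (set_reg (Suc d) m (set_reg d x \<sigma>))) (aval a \<sigma>) (bound e \<sigma>)) \<sigma>)"

text \<open>Register \<open>1\<close> is excluded because the code of every subformula overwrites
  it.\<close>

primrec wfa :: "nat \<Rightarrow> aexp \<Rightarrow> bool" where
  "wfa d (Num n) \<longleftrightarrow> True"
| "wfa d (Reg x) \<longleftrightarrow> x < d \<and> x \<noteq> 1"
| "wfa d (Get a e) \<longleftrightarrow> a < d \<and> wfa d e"
| "wfa d (Plus e f) \<longleftrightarrow> wfa d e \<and> wfa d f"
| "wfa d (Minus e f) \<longleftrightarrow> wfa d e \<and> wfa d f"

primrec wf_fm :: "fm \<Rightarrow> nat \<Rightarrow> bool" where
  "wf_fm (FLess a b) d \<longleftrightarrow> wfa d a \<and> wfa d b"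
| "wf_fm (FNot \<phi>) d \<longleftrightarrow> wf_fm \<phi> d"
| "wf_fm (FAnd \<phi> \<psi>) d \<longleftrightarrow> wf_fm \<phi> d \<and> wf_fm \<psi> d"
| "wf_fm (FEx e \<phi>) d \<longleftrightarrow> wfa d e \<and> wf_fm \<phi> (Suc d)"
| "wf_fm (FFill e \<phi> \<psi>) d \<longleftrightarrow> wfa d e \<and> wf_fm \<phi> (Suc d) \<and> wf_fm \<psi> (Suc d)"
| "wf_fm (FIter e a f \<psi>) d \<longleftrightarrow> wfa d e \<and> wfa d a \<and> wfa (Suc (Suc d)) f \<and> wf_fm \<psi> (Suc d)"

abbreviation incr :: "nat \<Rightarrow> com" where
  "incr d \<equiv> Assign d (Plus (Reg d) (Num 1))"

abbreviation below :: "nat \<Rightarrow> aexp \<Rightarrow> bexp" where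
  "below d e \<equiv> Conj (Less (Reg d) e) (Less (Reg d) (Reg 0))"

text \<open>The \<open>FEx\<close> loop stops at the first witness, so that register
  \<open>1\<close> keeps its verdict. In \<open>FFill\<close>, register \<open>d\<close> is reset
  because \<open>fval\<close> evaluates the body with \<open>d\<close> at 0, and the last loop
  erases array \<open>d\<close> so that the same code can run again inside an enclosing
  loop.\<close>

primrec compile :: "fm \<Rightarrow> nat \<Rightarrow> com" where
  "compile (FLess a b) d = If (Less a b) (Assign 1 (Num 1)) (Assign 1 (Num 0))"
| "compile (FNot \<phi>) d = Seq (compile \<phi> d) (Assign 1 (Minus (Num 1) (Reg 1)))"
| "compile (FAnd \<phi> \<psi>) d =
     Seq (compile \<phi> d) (If (Less (Num 0) (Reg 1)) (compile \<psi> d) Skip)"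
| "compile (FEx e \<phi>) d = Seq (Assign d (Num 0)) (Seq (Assign 1 (Num 0))
     (While (Conj (Less (Reg 1) (Num 1)) (below d e)) (Seq (compile \<phi> (Suc d)) (incr d))))"
| "compile (FFill e \<phi> \<psi>) d = Seq (Assign d (Num 0)) (Seq
     (While (below d e) (Seq (compile \<phi> (Suc d)) (Seq (Store d (Reg d) (Reg 1)) (incr d))))
     (Seq (Assign d (Num 0)) (Seq (compile \<psi> (Suc d)) (Seq (Assign d (Num 0))
     (While (below d e) (Seq (Store d (Reg d) (Num 0)) (incr d)))))))"
| "compile (FIter e a f \<psi>) d = Seq (Assign d a) (Seq (Assign (Suc d) (Num 0)) (Seq
     (While (below (Suc d) e) (Seq (Assign d f) (incr (Suc d)))) (compile \<psi> (Suc d))))"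

primrec time_poly :: "fm \<Rightarrow> nat poly" where
  "time_poly (FLess a b) = [:2:]"
| "time_poly (FNot \<phi>) = time_poly \<phi> + [:1:]"
| "time_poly (FAnd \<phi> \<psi>) = time_poly \<phi> + time_poly \<psi> + [:2:]"
| "time_poly (FEx e \<phi>) = [:0, 1:] * (time_poly \<phi> + [:2:]) + [:3:]"
| "time_poly (FFill e \<phi> \<psi>) =
     [:0, 1:] * (time_poly \<phi> + [:3:]) + time_poly \<psi> + [:0, 1:] * [:3:] + [:5:]"
| "time_poly (FIter e a f \<psi>) = [:0, 1:] * [:3:] + time_poly \<psi> + [:3:]"

section \<open>A Hoare logic with time bounds, and the correctness of the compiler\<close>

definition runs :: "com \<Rightarrow> state \<Rightarrow> nat \<Rightarrow> (state \<Rightarrow> bool) \<Rightarrow> bool" where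
  "runs c \<sigma> T Q \<longleftrightarrow> (\<exists>t \<tau>. exec c \<sigma> t \<tau> \<and> t \<le> T \<and> Q \<tau>)"

lemma runs_mono:
  assumes "runs c \<sigma> T Q" and "T \<le> T'" and "\<And>\<tau>. Q \<tau> \<Longrightarrow> Q' \<tau>"
  shows "runs c \<sigma> T' Q'"
proof -
  from assms(1) obtain t \<tau> where "exec c \<sigma> t \<tau>" "t \<le> T" "Q \<tau>" unfolding runs_def by blast
  then show ?thesis using assms(2,3) unfolding runs_def by (intro exI[of _ t] exI[of _ \<tau>]) auto
qed

lemma runs_Skip: "Q \<sigma> \<Longrightarrow> runs Skip \<sigma> 1 Q"
  unfolding runs_def by (intro exI conjI, rule exec.Skip) auto

lemma runs_Assign: "Q (set_reg x (aval e \<sigma>) \<sigma>) \<Longrightarrow> runs (Assign x e) \<sigma> 1 Q"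
  unfolding runs_def set_reg_def by (intro exI conjI, rule exec.Assign) auto

lemma runs_Store:
  "Q (set_arr a ((snd \<sigma> a)(aval i \<sigma> := aval e \<sigma>)) \<sigma>) \<Longrightarrow> runs (Store a i e) \<sigma> 1 Q"
  unfolding runs_def set_arr_def by (intro exI conjI, rule exec.Store) auto

lemma runs_Seq:
  assumes "runs c1 \<sigma> T1 (\<lambda>\<sigma>'. runs c2 \<sigma>' T2 Q)"
  shows "runs (Seq c1 c2) \<sigma> (T1 + T2) Q"
proof -
  from assms obtain t1 \<sigma>' t2 \<tau> where "exec c1 \<sigma> t1 \<sigma>'" "t1 \<le> T1" "exec c2 \<sigma>' t2 \<tau>" "t2 \<le> T2" "Q \<tau>"
    unfolding runs_def by blast
  then show ?thesis unfolding runs_def by (meson exec.Seq add_mono)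
qed

lemma runs_If:
  assumes "bval b \<sigma> \<Longrightarrow> runs c1 \<sigma> T Q" and "\<not> bval b \<sigma> \<Longrightarrow> runs c2 \<sigma> T Q"
  shows "runs (If b c1 c2) \<sigma> (Suc T) Q"
proof (cases "bval b \<sigma>")
  case True
  then obtain t \<tau> where "exec c1 \<sigma> t \<tau>" "t \<le> T" "Q \<tau>" using assms(1) unfolding runs_def by blast
  with exec.IfTrue[OF True] show ?thesis unfolding runs_def by fastforce
next
  case False
  then obtain t \<tau> where "exec c2 \<sigma> t \<tau>" "t \<le> T" "Q \<tau>" using assms(2) unfolding runs_def by blast
  with exec.IfFalse[OF False] show ?thesis unfolding runs_def by fastforce
qed

text \<open>\<open>m\<close> counts completed rounds. A true guard forces \<open>m < N\<close>, so
  \<open>N - m\<close> is the variant; each round costs \<open>T\<close> for the body and one step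
  for the test.\<close>

lemma runs_While:
  assumes step: "\<And>m \<sigma>. I m \<sigma> \<Longrightarrow> bval b \<sigma> \<Longrightarrow> m < N \<and> runs c \<sigma> T (I (Suc m))"
    and "I m \<sigma>"
  shows "runs (While b c) \<sigma> ((N - m) * Suc T + 1) (\<lambda>\<tau>. \<exists>m. I m \<tau> \<and> \<not> bval b \<tau>)"
  using assms(2)
proof (induction "N - m" arbitrary: m \<sigma> rule: less_induct)
  case less
  show ?case
  proof (cases "bval b \<sigma>")
    case False
    then show ?thesis unfolding runs_def using exec.WhileFalse[OF False] less.prems
      by (metis le_add2)
  next
    case True
    from step[OF less.prems True] obtain t \<sigma>' where m: "m < N"
      and t: "exec c \<sigma> t \<sigma>'" "t \<le> T" "I (Suc m) \<sigma>'"
      unfolding runs_def by blast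
    from less.hyps[OF _ t(3)] m obtain u \<tau> where
      u: "exec (While b c) \<sigma>' u \<tau>" "u \<le> (N - Suc m) * Suc T + 1" "\<exists>m. I m \<tau> \<and> \<not> bval b \<tau>"
      unfolding runs_def by (metis diff_less_mono2 lessI)
    have "N - m = Suc (N - Suc m)" using m by simp
    then have "1 + t + u \<le> (N - m) * Suc T + 1" using t(2) u(2) by simp
    with exec.WhileTrue[OF True t(1) u(1)] u(3) show ?thesis unfolding runs_def by blast
  qed
qed

text \<open>This is equality of everything a formula at depth \<open>d\<close> may read; compiled
  code uses register \<open>1\<close> and the registers from \<open>d\<close> on as scratch
  space.\<close>

definition agree :: "nat \<Rightarrow> state \<Rightarrow> state \<Rightarrow> bool" where
  "agree d \<sigma> \<tau> \<longleftrightarrow> (\<forall>r < d. r \<noteq> 1 \<longrightarrow> fst \<tau> r = fst \<sigma> r) \<and> (\<forall>a < d. snd \<tau> a = snd \<sigma> a)"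

lemma aval_agree:
  assumes "agree d \<sigma> \<tau>" and "wfa d e"
  shows "aval e \<sigma> = aval e \<tau>"
  using assms by (induction e) (auto simp: agree_def)

lemma bound_agree:
  assumes "agree d \<sigma> \<tau>" and "wfa d e" and "2 \<le> d"
  shows "bound e \<sigma> = bound e \<tau>"
  using aval_agree[OF assms(1,2)] assms unfolding bound_def by (simp add: agree_def)

lemma agree_set_reg: "agree d \<sigma> \<tau> \<Longrightarrow> agree (Suc d) (set_reg d i \<sigma>) (set_reg d i \<tau>)
  \<longleftrightarrow> snd \<sigma> d = snd \<tau> d"
  by (auto simp: agree_def less_Suc_eq)

lemma agree_set_both: "agree d \<sigma> \<tau> \<Longrightarrow>
  agree (Suc d) (set_reg d i (set_arr d f \<sigma>)) (set_reg d i (set_arr d f \<tau>))"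
  by (auto simp: agree_def less_Suc_eq)

text \<open>\<open>fill\<close> is zero beyond the filled part, whereas a store changes a single
  cell, so the machine reproduces \<open>fill\<close> only from a blank array.\<close>

definition clean :: "nat \<Rightarrow> state \<Rightarrow> bool" where
  "clean d \<sigma> \<longleftrightarrow> (\<forall>a \<ge> d. snd \<sigma> a = (\<lambda>_. 0))"

text \<open>Running a subformula may alter register \<open>1\<close> and the registers from
  \<open>d\<close> on; formulas evaluated afterwards do not notice.\<close>

lemma fval_agree:
  assumes "agree d \<sigma> \<tau>" and "snd \<sigma> = snd \<tau>" and "wf_fm \<phi> d" and "2 \<le> d"
  shows "fval \<phi> d \<sigma> = fval \<phi> d \<tau>"
  using assms
proof (induction \<phi> arbitrary: d \<sigma> \<tau>)
  case (FLess a b)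
  then show ?case using aval_agree by (metis fval.simps(1) wf_fm.simps(1))
next
  case (FNot \<phi>)
  from FNot.IH[OF FNot.prems(1,2) _ FNot.prems(4)] FNot.prems(3) show ?case by simp
next
  case (FAnd \<phi> \<psi>)
  from FAnd.IH[OF FAnd.prems(1,2) _ FAnd.prems(4)] FAnd.prems(3) show ?case by simp
next
  case (FEx e \<phi>)
  have "fval \<phi> (Suc d) (set_reg d i \<sigma>) = fval \<phi> (Suc d) (set_reg d i \<tau>)" for i
    using FEx.prems by (intro FEx.IH) (auto simp: agree_set_reg)
  moreover have "bound e \<sigma> = bound e \<tau>" using FEx.prems by (intro bound_agree) auto
  ultimately show ?case by simp
next
  case (FFill e \<phi> \<psi>)
  have "fval \<phi> (Suc d) (set_reg d i (set_arr d f \<sigma>)) = fval \<phi> (Suc d) (set_reg d i (set_arr d f \<tau>))" for i f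
    using FFill.prems by (intro FFill.IH(1)) (auto simp: agree_set_both)
  moreover have "bound e \<sigma> = bound e \<tau>" using FFill.prems by (intro bound_agree) auto
  moreover have "fval \<psi> (Suc d) (set_arr d f (set_reg d i \<sigma>)) = fval \<psi> (Suc d) (set_arr d f (set_reg d i \<tau>))" for i f
    using FFill.prems by (intro FFill.IH(2)) (auto simp: agree_def less_Suc_eq)
  ultimately show ?case by simp
next
  case (FIter e a f \<psi>)
  have "aval f (set_reg (Suc d) m (set_reg d x \<sigma>)) = aval f (set_reg (Suc d) m (set_reg d x \<tau>))" for m x
    using FIter.prems by (intro aval_agree[of "Suc (Suc d)"]) (auto simp: agree_def less_Suc_eq)
  moreover have "bound e \<sigma> = bound e \<tau>" using FIter.prems by (intro bound_agree) auto
  moreover have "aval a \<sigma> = aval a \<tau>" using FIter.prems by (intro aval_agree) auto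
  moreover have "fval \<psi> (Suc d) (set_reg d i \<sigma>) = fval \<psi> (Suc d) (set_reg d i \<tau>)" for i
    using FIter.prems by (intro FIter.IH) (auto simp: agree_set_reg)
  ultimately show ?case by simp
qed

lemma fill_beyond: "m \<le> i \<Longrightarrow> fill P m i = 0"
  by (induction m) auto

lemma fill_before: "i < m \<Longrightarrow> fill P m i = of_bool (P i (fill P i))"
  by (induction m) (auto simp: less_Suc_eq)

text \<open>Arrays are restored at every index, not only below \<open>d\<close>; this keeps
  \<open>clean\<close> available when code is run in sequence or repeatedly.\<close>

definition spec :: "fm \<Rightarrow> nat \<Rightarrow> state \<Rightarrow> state \<Rightarrow> bool" where
  "spec \<phi> d \<sigma> \<tau> \<longleftrightarrow> agree d \<sigma> \<tau> \<and> snd \<tau> = snd \<sigma> \<and> fst \<tau> 1 = of_bool (fval \<phi> d \<sigma>)"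

theorem compile_runs:
  assumes "wf_fm \<phi> d" and "2 \<le> d" and "clean d \<sigma>"
  shows "runs (compile \<phi> d) \<sigma> (poly (time_poly \<phi>) (fst \<sigma> 0)) (spec \<phi> d \<sigma>)"
  using assms
proof (induction \<phi> arbitrary: d \<sigma>)
  case (FLess a b)
  have "runs (compile (FLess a b) d) \<sigma> (Suc 1) (spec (FLess a b) d \<sigma>)"
    unfolding compile.simps using FLess.prems
    by (intro runs_If runs_Assign) (auto simp: spec_def agree_def)
  then show ?case by (simp add: numeral_2_eq_2)
next
  case (FNot \<phi>)
  have "runs (compile (FNot \<phi>) d) \<sigma> (poly (time_poly \<phi>) (fst \<sigma> 0) + 1) (spec (FNot \<phi>) d \<sigma>)"
    unfolding compile.simps
  proof (rule runs_Seq, rule runs_mono[OF FNot.IH order_refl], goal_cases)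
    case (4 \<tau>)
    then show ?case using FNot.prems by (intro runs_Assign) (auto simp: spec_def agree_def)
  qed (use FNot.prems in auto)
  then show ?case by simp
next
  case (FAnd \<phi> \<psi>)
  have "runs (compile (FAnd \<phi> \<psi>) d) \<sigma> (poly (time_poly \<phi>) (fst \<sigma> 0) +
     Suc (Suc (poly (time_poly \<psi>) (fst \<sigma> 0)))) (spec (FAnd \<phi> \<psi>) d \<sigma>)"
    unfolding compile.simps
  proof (rule runs_Seq, rule runs_mono[OF FAnd.IH(1) order_refl], goal_cases)
    case (4 \<tau>)
    show ?case
    proof (rule runs_If)
      have "fval \<psi> d \<sigma> = fval \<psi> d \<tau>"
        by (rule fval_agree) (use 4 FAnd.prems in \<open>auto simp: spec_def\<close>)
      then have eq: "fst \<tau> 0 = fst \<sigma> 0" "fval \<psi> d \<tau> = fval \<psi> d \<sigma>" "clean d \<tau>"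
        using 4 FAnd.prems by (simp_all add: spec_def agree_def clean_def)
      show "runs (compile \<psi> d) \<tau> (Suc (poly (time_poly \<psi>) (fst \<sigma> 0))) (spec (FAnd \<phi> \<psi>) d \<sigma>)"
        if "bval (Less (Num 0) (Reg 1)) \<tau>"
      proof (rule runs_mono[OF FAnd.IH(2)])
        show "spec (FAnd \<phi> \<psi>) d \<sigma> \<rho>" if "spec \<psi> d \<tau> \<rho>" for \<rho>
          using that 4 eq \<open>bval (Less (Num 0) (Reg 1)) \<tau>\<close> by (auto simp: spec_def agree_def)
      qed (use eq FAnd.prems in auto)
      show "runs Skip \<tau> (Suc (poly (time_poly \<psi>) (fst \<sigma> 0))) (spec (FAnd \<phi> \<psi>) d \<sigma>)"
        if "\<not> bval (Less (Num 0) (Reg 1)) \<tau>"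
        by (rule runs_mono[OF runs_Skip[of "spec (FAnd \<phi> \<psi>) d \<sigma>"]])
          (use 4 that in \<open>auto simp: spec_def\<close>)
    qed
  qed (use FAnd.prems in auto)
  then show ?case by simp
next
  case (FEx e \<phi>)
  let ?L = "fst \<sigma> 0" and ?P = "\<lambda>i. fval \<phi> (Suc d) (set_reg d i \<sigma>)"
  let ?T = "poly (time_poly \<phi>) ?L"
  define I where "I m \<tau> \<longleftrightarrow> agree d \<sigma> \<tau> \<and> snd \<tau> = snd \<sigma> \<and> fst \<tau> d = m \<and> m \<le> bound e \<sigma>
    \<and> fst \<tau> 1 = of_bool (\<exists>i<m. ?P i)" for m \<tau>
  have I0: "I 0 (set_reg 1 0 (set_reg d 0 \<sigma>))"
    using FEx.prems by (auto simp: I_def agree_def)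
  have bound: "aval e \<tau> = aval e \<sigma>" "fst \<tau> 0 = ?L" if "I m \<tau>" for m \<tau>
    using that FEx.prems aval_agree[of d \<sigma> \<tau> e] by (auto simp: I_def agree_def)
  have "runs (While (Conj (Less (Reg 1) (Num 1)) (below d e)) (Seq (compile \<phi> (Suc d)) (incr d)))
      (set_reg 1 0 (set_reg d 0 \<sigma>)) ((bound e \<sigma> - 0) * Suc (?T + 1) + 1)
      (\<lambda>\<tau>. \<exists>m. I m \<tau> \<and> \<not> bval (Conj (Less (Reg 1) (Num 1)) (below d e)) \<tau>)"
  proof (rule runs_While[where I = I, OF _ I0], intro conjI runs_Seq)
    fix m \<tau> assume I: "I m \<tau>" and b: "bval (Conj (Less (Reg 1) (Num 1)) (below d e)) \<tau>"
    then show m: "m < bound e \<sigma>" using bound[OF I] by (auto simp: I_def bound_def)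
    have ag: "agree (Suc d) (set_reg d m \<sigma>) \<tau>" "fst \<tau> 0 = ?L" "snd \<tau> = snd \<sigma>"
      using I FEx.prems by (auto simp: I_def agree_def less_Suc_eq)
    have no: "\<not> (\<exists>i<m. ?P i)" using I b by (auto simp: I_def)
    have fv: "fval \<phi> (Suc d) \<tau> = ?P m"
      using fval_agree[OF ag(1)] ag FEx.prems by simp
    show "runs (compile \<phi> (Suc d)) \<tau> ?T (\<lambda>\<tau>. runs (incr d) \<tau> 1 (I (Suc m)))"
    proof (rule runs_mono[OF FEx.IH[of "Suc d" \<tau>]], goal_cases)
      case \<rho>: (5 \<rho>)
      have "(\<exists>i<Suc m. ?P i) = ?P m" using no by (auto simp: less_Suc_eq)
      with \<rho> fv have "fst \<rho> 1 = of_bool (\<exists>i<Suc m. ?P i)" by (simp add: spec_def)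
      then have "I (Suc m) (set_reg d (aval (Plus (Reg d) (Num 1)) \<rho>) \<rho>)"
        using \<rho> I m FEx.prems by (auto simp: spec_def I_def agree_def)
      then show ?case by (rule runs_Assign)
    qed (use FEx.prems ag in \<open>auto simp: clean_def\<close>)
  qed
  then have "runs (While (Conj (Less (Reg 1) (Num 1)) (below d e)) (Seq (compile \<phi> (Suc d)) (incr d)))
      (set_reg 1 0 (set_reg d 0 \<sigma>)) (?L * (?T + 2) + 1) (spec (FEx e \<phi>) d \<sigma>)"
  proof (rule runs_mono)
    show "(bound e \<sigma> - 0) * Suc (?T + 1) + 1 \<le> ?L * (?T + 2) + 1"
    proof -
      have "bound e \<sigma> \<le> ?L" by (simp add: bound_def)
      then have "bound e \<sigma> * Suc (?T + 1) \<le> ?L * Suc (?T + 1)" by (rule mult_le_mono1)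
      then show ?thesis by (simp add: algebra_simps)
    qed
    fix \<tau> assume "\<exists>m. I m \<tau> \<and> \<not> bval (Conj (Less (Reg 1) (Num 1)) (below d e)) \<tau>"
    then obtain m where I: "I m \<tau>" and b: "\<not> bval (Conj (Less (Reg 1) (Num 1)) (below d e)) \<tau>"
      by blast
    have "(\<exists>i<m. ?P i) \<longleftrightarrow> (\<exists>i<bound e \<sigma>. ?P i)"
    proof (cases "\<exists>i<m. ?P i")
      case True
      then show ?thesis using I by (auto simp: I_def intro: order_less_le_trans)
    next
      case False
      then have "m = bound e \<sigma>" using b I bound[OF I] by (auto simp: I_def bound_def)
      then show ?thesis by simp
    qed
    then show "spec (FEx e \<phi>) d \<sigma> \<tau>" using I by (auto simp: I_def spec_def)
  qed
  then have "runs (compile (FEx e \<phi>) d) \<sigma> (1 + (1 + (?L * (?T + 2) + 1))) (spec (FEx e \<phi>) d \<sigma>)"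
    unfolding compile.simps by (intro runs_Seq runs_Assign) simp
  then show ?case by (elim runs_mono) (simp_all add: algebra_simps)
next
  case (FFill e \<phi> \<psi>)
  let ?L = "fst \<sigma> 0" and ?F = "fill (\<lambda>v f. fval \<phi> (Suc d) (set_reg d v (set_arr d f \<sigma>)))"
  let ?T = "poly (time_poly \<phi>) ?L" and ?U = "poly (time_poly \<psi>) ?L"
  define I where "I m \<tau> \<longleftrightarrow> agree d \<sigma> \<tau> \<and> snd \<tau> = (snd \<sigma>)(d := ?F m) \<and> fst \<tau> d = m
    \<and> m \<le> bound e \<sigma>" for m \<tau>
  \<comment> \<open>Invariant of the erasing loop; register \<open>1\<close> already carries the
    value of the body and must survive.\<close>
  define J where "J m \<tau> \<longleftrightarrow> agree d \<sigma> \<tau> \<and> (\<forall>i<m. snd \<tau> d i = 0) \<and>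
    (\<forall>i\<ge>m. snd \<tau> d i = ?F (bound e \<sigma>) i) \<and> (\<forall>a. a \<noteq> d \<longrightarrow> snd \<tau> a = snd \<sigma> a)
    \<and> fst \<tau> d = m \<and> m \<le> bound e \<sigma> \<and> fst \<tau> 1 = of_bool (fval (FFill e \<phi> \<psi>) d \<sigma>)" for m \<tau>
  have bound: "aval e \<tau> = aval e \<sigma>" "fst \<tau> 0 = ?L" if "agree d \<sigma> \<tau>" for \<tau>
    using that FFill.prems aval_agree[of d \<sigma> \<tau> e] by (auto simp: agree_def)
  have I0: "I 0 (set_reg d 0 \<sigma>)"
    using FFill.prems by (auto simp: I_def agree_def clean_def)
  have "runs (While (below d e) (Seq (compile \<phi> (Suc d)) (Seq (Store d (Reg d) (Reg 1)) (incr d))))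
      (set_reg d 0 \<sigma>) ((bound e \<sigma> - 0) * Suc (?T + (1 + 1)) + 1)
      (\<lambda>\<tau>. \<exists>m. I m \<tau> \<and> \<not> bval (below d e) \<tau>)"
  proof (rule runs_While[where I = I, OF _ I0], intro conjI runs_Seq)
    fix m \<tau> assume I: "I m \<tau>" and b: "bval (below d e) \<tau>"
    then show m: "m < bound e \<sigma>" using bound by (auto simp: I_def bound_def)
    have ag: "agree (Suc d) (set_reg d m (set_arr d (?F m) \<sigma>)) \<tau>" "fst \<tau> 0 = ?L"
      using I FFill.prems by (auto simp: I_def agree_def less_Suc_eq)
    have fv: "fval \<phi> (Suc d) \<tau> = fval \<phi> (Suc d) (set_reg d m (set_arr d (?F m) \<sigma>))"
      using fval_agree[OF ag(1)] I FFill.prems by (simp add: I_def)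
    show "runs (compile \<phi> (Suc d)) \<tau> ?T
      (\<lambda>\<tau>. runs (Seq (Store d (Reg d) (Reg 1)) (incr d)) \<tau> (1 + 1) (I (Suc m)))"
    proof (rule runs_mono[OF FFill.IH(1)[of "Suc d" \<tau>]], goal_cases)
      case \<rho>: (5 \<rho>)
      have "snd \<rho> = (snd \<sigma>)(d := ?F m)" "fst \<rho> d = m" "agree d \<sigma> \<rho>"
        "fst \<rho> 1 = of_bool (fval \<phi> (Suc d) (set_reg d m (set_arr d (?F m) \<sigma>)))"
        using \<rho> I FFill.prems fv by (auto simp: spec_def I_def agree_def)
      then have "I (Suc m) (set_reg d (aval (Plus (Reg d) (Num 1))
          (set_arr d ((snd \<rho> d)(aval (Reg d) \<rho> := aval (Reg 1) \<rho>)) \<rho>))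
          (set_arr d ((snd \<rho> d)(aval (Reg d) \<rho> := aval (Reg 1) \<rho>)) \<rho>))"
        using m FFill.prems by (auto simp: I_def agree_def)
      then show ?case by (intro runs_Seq runs_Store runs_Assign)
    qed (use FFill.prems I ag in \<open>auto simp: clean_def I_def\<close>)
  qed
  then have 1: "runs (While (below d e) (Seq (compile \<phi> (Suc d)) (Seq (Store d (Reg d) (Reg 1)) (incr d))))
      (set_reg d 0 \<sigma>) (?L * (?T + 3) + 1) (I (bound e \<sigma>))"
  proof (rule runs_mono)
    show "(bound e \<sigma> - 0) * Suc (?T + (1 + 1)) + 1 \<le> ?L * (?T + 3) + 1"
    proof -
      have "bound e \<sigma> \<le> ?L" by (simp add: bound_def)
      then have "bound e \<sigma> * Suc (?T + (1 + 1)) \<le> ?L * Suc (?T + (1 + 1))" by (rule mult_le_mono1)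
      then show ?thesis by (simp add: algebra_simps)
    qed
    fix \<tau> assume "\<exists>m. I m \<tau> \<and> \<not> bval (below d e) \<tau>"
    then obtain m where I: "I m \<tau>" and b: "\<not> bval (below d e) \<tau>" by blast
    then have "m = bound e \<sigma>" using bound by (auto simp: I_def bound_def)
    then show "I (bound e \<sigma>) \<tau>" using I by simp
  qed
  have 2: "runs (compile \<psi> (Suc d)) (set_reg d 0 \<tau>) ?U (\<lambda>\<tau>. J 0 (set_reg d 0 \<tau>))"
    if I: "I (bound e \<sigma>) \<tau>" for \<tau>
  proof (rule runs_mono[OF FFill.IH(2)])
    let ?\<rho> = "set_arr d (?F (bound e \<sigma>)) (set_reg d 0 \<sigma>)"
    fix \<tau>' assume *: "spec \<psi> (Suc d) (set_reg d 0 \<tau>) \<tau>'"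
    have "fval \<psi> (Suc d) ?\<rho> = fval \<psi> (Suc d) (set_reg d 0 \<tau>)"
      using I FFill.prems by (intro fval_agree) (auto simp: I_def agree_def less_Suc_eq)
    then show "J 0 (set_reg d 0 \<tau>')"
      using * I FFill.prems by (auto simp: J_def spec_def I_def agree_def)
  qed (use that FFill.prems in \<open>auto simp: I_def agree_def clean_def\<close>)
  have 3: "runs (While (below d e) (Seq (Store d (Reg d) (Num 0)) (incr d))) \<tau> (?L * 3 + 1)
      (spec (FFill e \<phi> \<psi>) d \<sigma>)" if J0: "J 0 \<tau>" for \<tau>
  proof (rule runs_mono)
    show "runs (While (below d e) (Seq (Store d (Reg d) (Num 0)) (incr d))) \<tau>
      ((bound e \<sigma> - 0) * Suc (1 + 1) + 1) (\<lambda>\<tau>. \<exists>m. J m \<tau> \<and> \<not> bval (below d e) \<tau>)"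
    proof (rule runs_While[where I = J, OF _ J0], intro conjI runs_Seq runs_Store runs_Assign)
      fix m \<tau> assume J: "J m \<tau>" and b: "bval (below d e) \<tau>"
      then show m: "m < bound e \<sigma>" using bound by (auto simp: J_def bound_def)
      show "J (Suc m) (set_reg d (aval (Plus (Reg d) (Num 1))
          (set_arr d ((snd \<tau> d)(aval (Reg d) \<tau> := aval (Num 0) \<tau>)) \<tau>))
          (set_arr d ((snd \<tau> d)(aval (Reg d) \<tau> := aval (Num 0) \<tau>)) \<tau>))"
        using J m FFill.prems by (auto simp: J_def agree_def)
    qed
    show "(bound e \<sigma> - 0) * Suc (1 + 1) + 1 \<le> ?L * 3 + 1" by (simp add: bound_def)
    fix \<tau> assume "\<exists>m. J m \<tau> \<and> \<not> bval (below d e) \<tau>"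
    then obtain m where J: "J m \<tau>" and b: "\<not> bval (below d e) \<tau>" by blast
    then have m: "m = bound e \<sigma>" using bound by (auto simp: J_def bound_def)
    have "snd \<tau> d i = 0" for i
      using J fill_beyond[of m i] by (cases "i < m") (auto simp: J_def m)
    then have "snd \<tau> d = snd \<sigma> d" using FFill.prems by (auto simp: clean_def)
    then have "snd \<tau> a = snd \<sigma> a" for a using J by (cases "a = d") (auto simp: J_def)
    then show "spec (FFill e \<phi> \<psi>) d \<sigma> \<tau>" using J by (auto simp: J_def spec_def)
  qed
  have "runs (compile (FFill e \<phi> \<psi>) d) \<sigma> (1 + ((?L * (?T + 3) + 1) + (1 + (?U + (1 + (?L * 3 + 1))))))
    (spec (FFill e \<phi> \<psi>) d \<sigma>)"
    unfolding compile.simps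
    apply (rule runs_Seq, rule runs_Assign, simp only: aval.simps)
    apply (rule runs_Seq, rule runs_mono[OF 1 order_refl])
    apply (rule runs_Seq, rule runs_Assign, simp only: aval.simps)
    apply (rule runs_Seq, rule runs_mono[OF 2 order_refl], assumption)
    apply (rule runs_Seq, rule runs_Assign, simp only: aval.simps)
    apply (erule 3)
    done
  then show ?case by (elim runs_mono) (simp_all add: algebra_simps)
next
  case (FIter e a f \<psi>)
  let ?L = "fst \<sigma> 0"
  let ?F = "iterate (\<lambda>m x. aval f (set_reg (Suc d) m (set_reg d x \<sigma>))) (aval a \<sigma>)"
  let ?U = "poly (time_poly \<psi>) ?L"
  define I where "I m \<tau> \<longleftrightarrow> agree d \<sigma> \<tau> \<and> snd \<tau> = snd \<sigma> \<and> fst \<tau> (Suc d) = m \<and>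
    fst \<tau> d = ?F m \<and> m \<le> bound e \<sigma>" for m \<tau>
  have bound: "aval e \<tau> = aval e \<sigma>" "fst \<tau> 0 = ?L" if "agree d \<sigma> \<tau>" for \<tau>
    using that FIter.prems aval_agree[of d \<sigma> \<tau> e] by (auto simp: agree_def)
  have I0: "I 0 (set_reg (Suc d) 0 (set_reg d (aval a \<sigma>) \<sigma>))"
    using FIter.prems by (auto simp: I_def agree_def)
  have 1: "runs (While (below (Suc d) e) (Seq (Assign d f) (incr (Suc d))))
      (set_reg (Suc d) 0 (set_reg d (aval a \<sigma>) \<sigma>)) (?L * 3 + 1) (I (bound e \<sigma>))"
  proof (rule runs_mono)
    show "runs (While (below (Suc d) e) (Seq (Assign d f) (incr (Suc d))))
      (set_reg (Suc d) 0 (set_reg d (aval a \<sigma>) \<sigma>)) ((bound e \<sigma> - 0) * Suc (1 + 1) + 1)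
      (\<lambda>\<tau>. \<exists>m. I m \<tau> \<and> \<not> bval (below (Suc d) e) \<tau>)"
    proof (rule runs_While[where I = I, OF _ I0], intro conjI runs_Seq runs_Assign)
      fix m \<tau> assume I: "I m \<tau>" and b: "bval (below (Suc d) e) \<tau>"
      then show m: "m < bound e \<sigma>" using bound by (auto simp: I_def bound_def)
      have "aval f \<tau> = aval f (set_reg (Suc d) m (set_reg d (?F m) \<sigma>))"
        using I FIter.prems by (intro aval_agree[of "Suc (Suc d)"]) (auto simp: I_def agree_def less_Suc_eq)
      then show "I (Suc m) (set_reg (Suc d) (aval (Plus (Reg (Suc d)) (Num 1)) (set_reg d (aval f \<tau>) \<tau>))
          (set_reg d (aval f \<tau>) \<tau>))"
        using I m FIter.prems by (auto simp: I_def agree_def)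
    qed
    show "(bound e \<sigma> - 0) * Suc (1 + 1) + 1 \<le> ?L * 3 + 1" by (simp add: bound_def)
    fix \<tau> assume "\<exists>m. I m \<tau> \<and> \<not> bval (below (Suc d) e) \<tau>"
    then obtain m where I: "I m \<tau>" and b: "\<not> bval (below (Suc d) e) \<tau>" by blast
    then have "m = bound e \<sigma>" using bound by (auto simp: I_def bound_def)
    then show "I (bound e \<sigma>) \<tau>" using I by simp
  qed
  have 2: "runs (compile \<psi> (Suc d)) \<tau> ?U (spec (FIter e a f \<psi>) d \<sigma>)"
    if I: "I (bound e \<sigma>) \<tau>" for \<tau>
  proof (rule runs_mono[OF FIter.IH])
    fix \<tau>' assume *: "spec \<psi> (Suc d) \<tau> \<tau>'"
    have "fval \<psi> (Suc d) (set_reg d (?F (bound e \<sigma>)) \<sigma>) = fval \<psi> (Suc d) \<tau>"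
      using I FIter.prems by (intro fval_agree) (auto simp: I_def agree_def less_Suc_eq)
    then show "spec (FIter e a f \<psi>) d \<sigma> \<tau>'"
      using * I FIter.prems by (auto simp: spec_def I_def agree_def)
  qed (use that FIter.prems in \<open>auto simp: I_def agree_def clean_def\<close>)
  have "runs (compile (FIter e a f \<psi>) d) \<sigma> (1 + (1 + ((?L * 3 + 1) + ?U))) (spec (FIter e a f \<psi>) d \<sigma>)"
    unfolding compile.simps
    apply (rule runs_Seq, rule runs_Assign)
    apply (rule runs_Seq, rule runs_Assign, simp only: aval.simps)
    apply (rule runs_Seq, rule runs_mono[OF 1 order_refl])
    apply (erule 2)
    done
  then show ?case by (elim runs_mono) (simp_all add: algebra_simps)
qed

theorem solvable_in_poly_time_fm:
  assumes "wf_fm \<phi> 2" and "\<And>x. x \<in> D \<Longrightarrow> fval \<phi> 2 (init_state (enc x)) \<longleftrightarrow> x \<in> Y"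
  shows "solvable_in_poly_time enc D Y"
  unfolding solvable_in_poly_time_def
proof (rule exI, rule exI, rule ballI)
  fix x assume x: "x \<in> D"
  let ?\<sigma> = "init_state (enc x)"
  have "clean 2 ?\<sigma>" by (auto simp: clean_def init_state_def)
  then have "runs (compile \<phi> 2) ?\<sigma> (poly (time_poly \<phi>) (fst ?\<sigma> 0)) (spec \<phi> 2 ?\<sigma>)"
    using assms(1) by (intro compile_runs) auto
  \<comment> \<open>The verdict is in register \<open>1\<close>, but answers are read off register
    \<open>0\<close>.\<close>
  then have "runs (Seq (compile \<phi> 2) (Assign 0 (Reg 1))) ?\<sigma> (poly (time_poly \<phi>) (fst ?\<sigma> 0) + 1)
    (\<lambda>\<tau>. fst \<tau> 0 = of_bool (fval \<phi> 2 ?\<sigma>))"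
    by (rule runs_Seq[OF runs_mono[OF _ order_refl]])
      (rule runs_Assign, simp only: set_reg_simps aval.simps fun_upd_same spec_def)
  then obtain t \<tau> where t: "exec (Seq (compile \<phi> 2) (Assign 0 (Reg 1))) ?\<sigma> t \<tau>"
    "t \<le> poly (time_poly \<phi>) (fst ?\<sigma> 0) + 1" "fst \<tau> 0 = of_bool (fval \<phi> 2 ?\<sigma>)"
    unfolding runs_def by blast
  have "t \<le> poly (time_poly \<phi> + [:1:]) (length (enc x))" using t(2) by (simp add: init_state_def)
  moreover have "fst \<tau> 0 = (if x \<in> Y then 1 else 0)" using t(3) assms(2)[OF x] by simp
  ultimately show "\<exists>t \<tau>. exec (Seq (compile \<phi> 2) (Assign 0 (Reg 1))) ?\<sigma> t \<tau> \<and>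
      t \<le> poly (time_poly \<phi> + [:1:]) (length (enc x)) \<and> fst \<tau> 0 = (if x \<in> Y then 1 else 0)"
    using t(1) by blast
qed


section \<open>Induced matchings and maximal independent sets\<close>

text \<open>Distinctness of the \<open>2 * s\<close> vertices is implied: if
  \<open>f i = f j\<close> with \<open>i \<noteq> j\<close>, say, then \<open>f j\<close> would be
  adjacent to \<open>g i\<close>.\<close>

definition induced_matching :: "('a \<Rightarrow> 'a \<Rightarrow> bool) \<Rightarrow> nat \<Rightarrow> (nat \<Rightarrow> 'a) \<Rightarrow> (nat \<Rightarrow> 'a) \<Rightarrow> bool" where
  "induced_matching E s f g \<longleftrightarrow> (\<forall>i < s. E (f i) (g i)) \<and>
     (\<forall>i < s. \<forall>j < s. i \<noteq> j \<longrightarrow> \<not> E (f i) (f j) \<and> \<not> E (f i) (g j) \<and> \<not> E (g i) (g j))"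

definition matching_free :: "('a \<Rightarrow> 'a \<Rightarrow> bool) \<Rightarrow> nat \<Rightarrow> 'a set \<Rightarrow> bool" where
  "matching_free E s X \<longleftrightarrow>
     \<not> (\<exists>f g. f ` {..<s} \<subseteq> X \<and> g ` {..<s} \<subseteq> X \<and> induced_matching E s f g)"

definition independent :: "('a \<Rightarrow> 'a \<Rightarrow> bool) \<Rightarrow> 'a set \<Rightarrow> bool" where
  "independent E I \<longleftrightarrow> (\<forall>x \<in> I. \<forall>y \<in> I. \<not> E x y)"

definition maximal_independent :: "('a \<Rightarrow> 'a \<Rightarrow> bool) \<Rightarrow> 'a set \<Rightarrow> 'a set \<Rightarrow> bool" where
  "maximal_independent E X I \<longleftrightarrow> I \<subseteq> X \<and> independent E I \<and> (\<forall>x \<in> X - I. \<exists>y \<in> I. E x y)"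

lemma matching_free_mono:
  assumes "matching_free E s Y" and "X \<subseteq> Y"
  shows "matching_free E s X"
  using assms unfolding matching_free_def by (meson subset_trans)

lemma induced_matching_Suc:
  assumes "symp E" and "induced_matching E m f g" and "E u v"
    and "\<And>i. i < m \<Longrightarrow> \<not> E u (f i) \<and> \<not> E u (g i) \<and> \<not> E v (f i) \<and> \<not> E v (g i)"
  shows "induced_matching E (Suc m) (f(m := u)) (g(m := v))"
  using assms unfolding induced_matching_def by (auto simp: less_Suc_eq dest: sympD)

text \<open>The edge \<open>uv\<close> can be added to any induced matching among the common
  non-neighbours of its ends. This drives the induction on \<open>s\<close> in
  \<open>maximal_independent_pairs\<close>.\<close>

lemma matching_free_Suc:
  assumes "symp E" and "matching_free E (Suc m) X" and "u \<in> X" and "v \<in> X" and "E u v"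
  shows "matching_free E m {x \<in> X. \<not> E x u \<and> \<not> E x v}"
  unfolding matching_free_def
proof (rule notI, elim exE conjE)
  fix f g
  assume f: "f ` {..<m} \<subseteq> {x \<in> X. \<not> E x u \<and> \<not> E x v}"
    and g: "g ` {..<m} \<subseteq> {x \<in> X. \<not> E x u \<and> \<not> E x v}" and m: "induced_matching E m f g"
  have "induced_matching E (Suc m) (f(m := u)) (g(m := v))"
    using f g by (intro induced_matching_Suc assms m) (auto dest: sympD[OF assms(1)])
  moreover have "(f(m := u)) ` {..<Suc m} \<subseteq> X" "(g(m := v)) ` {..<Suc m} \<subseteq> X"
    using f g assms by (fastforce simp: less_Suc_eq image_subset_iff)+
  ultimately show False using assms(2) unfolding matching_free_def by blast
qed

lemma independent_extend:
  assumes "finite X" and "I \<subseteq> X" and "independent E I" and "symp E" and "\<And>x. \<not> E x x"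
  shows "\<exists>J. I \<subseteq> J \<and> maximal_independent E X J"
proof -
  define Q where "Q = {J. I \<subseteq> J \<and> J \<subseteq> X \<and> independent E J}"
  have "finite Q" "I \<in> Q"
    using assms by (auto simp: Q_def intro: finite_subset[of _ "Pow X"])
  from finite_has_maximal[OF this(1)] this(2)
  obtain J where J: "J \<in> Q" and max: "\<forall>K \<in> Q. J \<subseteq> K \<longrightarrow> J = K" by blast
  have "\<exists>y \<in> J. E x y" if x: "x \<in> X - J" for x
  proof (rule ccontr)
    assume "\<not> (\<exists>y \<in> J. E x y)"
    then have "independent E (insert x J)"
      using J assms(4,5) unfolding independent_def Q_def by (auto dest: sympD)
    then have "insert x J \<in> Q" using J x by (auto simp: Q_def)
    then show False using max x by blast
  qed
  then show ?thesis using J unfolding maximal_independent_def Q_def by blast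
qed

text \<open>
  The pairs record the steps at which an enumeration of the maximal independent sets of the initial
  segments of \<open>X\<close> departs from greedily extending the previous set: there, \<open>v\<close> enters and \<open>u\<close> is
  a smaller neighbour of \<open>v\<close> that has no other neighbour in the part of \<open>I\<close> below \<open>v\<close>.
\<close>

lemma maximal_independent_pairs:
  fixes E :: "'a :: linorder \<Rightarrow> 'a \<Rightarrow> bool"
  assumes "symp E" and "finite X" and "matching_free E (Suc s) X" and "maximal_independent E X I"
  shows "\<exists>ps. length ps \<le> s \<and> (\<forall>(v, u) \<in> set ps. v \<in> I \<and> u \<in> X \<and> (\<forall>x \<in> I. x < v \<longrightarrow> \<not> E x u)) \<and>
    (\<forall>x \<in> X - I. (\<exists>w \<in> I. w < x \<and> E x w) \<or> (\<exists>(v, u) \<in> set ps. E x v \<or> x < v \<and> E x u))"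
  using assms(2-)
proof (induction s arbitrary: X I)
  case (0 X I)
  have "\<exists>w \<in> I. w < x \<and> E x w" if x: "x \<in> X - I" for x
  proof -
    obtain y where y: "y \<in> I" "E x y" using 0(3) x unfolding maximal_independent_def by blast
    have "x \<in> X" "y \<in> X" using x y(1) 0(3) unfolding maximal_independent_def by blast+
    \<comment> \<open>No set is \<open>matching_free E 0\<close>, since the empty matching always
      exists; so no \<open>x\<close> outside \<open>I\<close> is left.\<close>
    then have "matching_free E 0 {z \<in> X. \<not> E z x \<and> \<not> E z y}"
      using matching_free_Suc[OF assms(1) 0(2) _ _ y(2)] by blast
    then show ?thesis by (simp add: matching_free_def induced_matching_def)
  qed
  then show ?case by (intro exI[of _ "[]"]) simp
next
  case (Suc s X I)
  have I: "I \<subseteq> X" "\<And>x y. x \<in> I \<Longrightarrow> y \<in> I \<Longrightarrow> \<not> E x y" "\<And>x. x \<in> X \<Longrightarrow> x \<notin> I \<Longrightarrow> \<exists>y \<in> I. E x y"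
    using Suc.prems(3) by (auto simp: maximal_independent_def independent_def)
  define D where "D = {v \<in> I. \<exists>u \<in> X. E v u \<and> u < v \<and> (\<forall>w \<in> I. w < v \<longrightarrow> \<not> E w u)}"
  have finI: "finite I" using I(1) Suc.prems(1) by (rule finite_subset)
  \<comment> \<open>A vertex wrongly left out by the greedy rule makes its least neighbour in
    \<open>I\<close> a departure.\<close>
  have late: "\<exists>v \<in> D. x < v" if x: "x \<in> X" "x \<notin> I" and no: "\<not> (\<exists>w \<in> I. w < x \<and> E x w)" for x
  proof -
    let ?N = "{w \<in> I. E x w}" and ?v = "Min {w \<in> I. E x w}"
    have fin: "finite ?N" "?N \<noteq> {}" using finI I(3)[OF x] by auto
    have v: "?v \<in> ?N" using fin by (rule Min_in)
    have "\<not> E w x" if "w \<in> I" "w < ?v" for w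
    proof
      assume "E w x"
      then have "w \<in> ?N" using that sympD[OF assms(1)] by blast
      then show False using Min_le[OF fin(1)] that(2) by fastforce
    qed
    moreover have "x < ?v" using no v x(2) by (metis (mono_tags, lifting) mem_Collect_eq linorder_neqE)
    ultimately show ?thesis using v x sympD[OF assms(1)] unfolding D_def by blast
  qed
  show ?case
  proof (cases "D = {}")
    case True
    then show ?thesis using late by (intro exI[of _ "[]"]) auto
  next
    case False
    have "finite D" using finI by (simp add: D_def)
    \<comment> \<open>The last departure. From \<open>v\<close> on the greedy rule is obeyed; below
      \<open>v\<close> the pair \<open>(v, u)\<close> accounts for the neighbours of
      \<open>u\<close> and \<open>v\<close>, and induction for the rest.\<close>
    define v where "v = Max D"
    have "v \<in> D" and max: "\<And>w. w \<in> D \<Longrightarrow> w \<le> v"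
      using False \<open>finite D\<close> by (simp_all add: v_def)
    then obtain u where u: "v \<in> I" "u \<in> X" "E v u" "u < v" "\<And>w. w \<in> I \<Longrightarrow> w < v \<Longrightarrow> \<not> E w u"
      unfolding D_def by blast
    define X' where "X' = {x \<in> X. x < v \<and> \<not> E x u \<and> \<not> E x v}"
    define I' where "I' = {x \<in> I. x < v}"
    have early: "\<exists>w \<in> I. w < x \<and> E x w" if "x \<in> X" "x \<notin> I" "v \<le> x" for x
      using late[OF that(1,2)] that(3) max by (meson leD le_less_trans order_less_le_trans)
    have "matching_free E (Suc s) {x \<in> X. \<not> E x v \<and> \<not> E x u}"
      using matching_free_Suc[OF assms(1) Suc.prems(2) _ u(2,3)] u(1) I(1) by blast
    then have free: "matching_free E (Suc s) X'"
      by (rule matching_free_mono) (auto simp: X'_def)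
    have "maximal_independent E X' I'"
      unfolding maximal_independent_def independent_def
    proof (intro conjI ballI)
      show "I' \<subseteq> X'" using I u by (auto simp: I'_def X'_def)
      fix x assume x: "x \<in> X' - I'"
      then have x': "x \<in> X" "x \<notin> I" "x < v" "\<not> E x u" "\<not> E x v" by (auto simp: X'_def I'_def)
      show "\<exists>y \<in> I'. E x y"
      proof (rule ccontr)
        \<comment> \<open>The least neighbour of \<open>x\<close> in \<open>I\<close> then exceeds
          \<open>v\<close>, and with \<open>x\<close> as its witness it would be a departure after
          the last one.\<close>
        assume no: "\<not> (\<exists>y \<in> I'. E x y)"
        let ?N = "{w \<in> I. E x w}" and ?w = "Min {w \<in> I. E x w}"
        have fin: "finite ?N" "?N \<noteq> {}" using finI I(3)[OF x'(1,2)] by auto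
        have w: "?w \<in> ?N" using fin by (rule Min_in)
        then have "v < ?w" using no x'(5) unfolding I'_def
          by (metis (mono_tags, lifting) mem_Collect_eq linorder_neqE)
        have "\<not> E y x" if "y \<in> I" "y < ?w" for y
        proof
          assume "E y x"
          then have "y \<in> ?N" using that sympD[OF assms(1)] by blast
          then show False using Min_le[OF fin(1)] that(2) by fastforce
        qed
        then have "?w \<in> D" using w x' \<open>v < ?w\<close> sympD[OF assms(1)] unfolding D_def
          by (auto intro!: bexI[of _ x])
        then show False using max \<open>v < ?w\<close> by (meson leD)
      qed
    qed (use I in \<open>auto simp: I'_def\<close>)
    from Suc.IH[OF _ free this] Suc.prems(1) obtain ps where ps: "length ps \<le> s"
      "\<forall>(v', u') \<in> set ps. v' \<in> I' \<and> u' \<in> X' \<and> (\<forall>x \<in> I'. x < v' \<longrightarrow> \<not> E x u')"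
      "\<forall>x \<in> X' - I'. (\<exists>w \<in> I'. w < x \<and> E x w) \<or> (\<exists>(v', u') \<in> set ps. E x v' \<or> x < v' \<and> E x u')"
      unfolding X'_def by (auto simp del: split_paired_Ex)
    show ?thesis
    proof (intro exI[of _ "(v, u) # ps"] conjI)
      show "length ((v, u) # ps) \<le> Suc s" using ps(1) by simp
      have "v' \<in> I \<and> u' \<in> X \<and> (\<forall>x \<in> I. x < v' \<longrightarrow> \<not> E x u')" if "(v', u') \<in> set ps" for v' u'
      proof -
        from ps(2) that have v': "v' \<in> I'" and "u' \<in> X'" and *: "\<forall>x \<in> I'. x < v' \<longrightarrow> \<not> E x u'" by auto
        moreover have "x \<in> I'" if "x \<in> I" "x < v'" for x
          using that v' by (auto simp: I'_def)
        ultimately show ?thesis by (auto simp: I'_def X'_def)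
      qed
      then show "\<forall>(v', u') \<in> set ((v, u) # ps). v' \<in> I \<and> u' \<in> X \<and> (\<forall>x \<in> I. x < v' \<longrightarrow> \<not> E x u')"
        using u by auto
      show "\<forall>x \<in> X - I. (\<exists>w \<in> I. w < x \<and> E x w) \<or>
        (\<exists>(v', u') \<in> set ((v, u) # ps). E x v' \<or> x < v' \<and> E x u')"
      proof
        fix x assume x: "x \<in> X - I"
        consider "v \<le> x" | "x < v" "E x u \<or> E x v" | "x < v" "\<not> E x u" "\<not> E x v" by fastforce
        then show "(\<exists>w \<in> I. w < x \<and> E x w) \<or>
          (\<exists>(v', u') \<in> set ((v, u) # ps). E x v' \<or> x < v' \<and> E x u')"
        proof cases
          case 1
          then show ?thesis using early x by blast
        next
          case 3
          then have "x \<in> X' - I'" using x by (auto simp: X'_def I'_def)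
          with ps(3) have "(\<exists>w \<in> I'. w < x \<and> E x w) \<or> (\<exists>(v', u') \<in> set ps. E x v' \<or> x < v' \<and> E x u')"
            by blast
          then show ?thesis unfolding I'_def by auto
        qed auto
      qed
    qed
  qed
qed


section \<open>Connected odd cycle transversals without large induced matchings\<close>

definition edges_in :: "('a \<Rightarrow> 'a \<Rightarrow> bool) \<Rightarrow> 'a set \<Rightarrow> ('a \<times> 'a) set" where
  "edges_in E S = {(x, y). x \<in> S \<and> y \<in> S \<and> E x y}"

definition connected_in :: "('a \<Rightarrow> 'a \<Rightarrow> bool) \<Rightarrow> 'a set \<Rightarrow> bool" where
  "connected_in E S \<longleftrightarrow> (\<forall>x \<in> S. \<forall>y \<in> S. (x, y) \<in> (edges_in E S)\<^sup>*)"

lemma edges_in_mono: "S \<subseteq> T \<Longrightarrow> edges_in E S \<subseteq> edges_in E T"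
  by (auto simp: edges_in_def)

lemma edges_in_rtrancl_mono: "(x, y) \<in> (edges_in E S)\<^sup>* \<Longrightarrow> S \<subseteq> T \<Longrightarrow> (x, y) \<in> (edges_in E T)\<^sup>*"
  using rtrancl_mono[OF edges_in_mono] by blast

lemma edges_in_rtrancl_sym: "symp E \<Longrightarrow> (x, y) \<in> (edges_in E S)\<^sup>* \<Longrightarrow> (y, x) \<in> (edges_in E S)\<^sup>*"
  by (rule symD[OF sym_rtrancl]) (auto simp: edges_in_def sym_def dest: sympD)

lemma connected_inI:
  assumes "symp E" and "\<And>y. y \<in> S \<Longrightarrow> (c, y) \<in> (edges_in E S)\<^sup>*"
  shows "connected_in E S"
  unfolding connected_in_def
proof (intro ballI)
  fix x y assume "x \<in> S" "y \<in> S"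
  then have "(x, c) \<in> (edges_in E S)\<^sup>*" "(c, y) \<in> (edges_in E S)\<^sup>*"
    using edges_in_rtrancl_sym[OF assms(1)] assms(2) by blast+
  then show "(x, y) \<in> (edges_in E S)\<^sup>*" by (rule rtrancl_trans)
qed

lemma relpow_segment:
  assumes "\<And>i. i < m \<Longrightarrow> (p i, p (Suc i)) \<in> R" and "a \<le> b" and "b \<le> m"
  shows "(p a, p b) \<in> R ^^ (b - a)"
  using assms unfolding relpow_fun_conv by (intro exI[of _ "\<lambda>i. p (a + i)"]) auto

text \<open>A shortest walk is an induced path; taking every third edge of it gives an induced matching.\<close>

lemma matching_free_walk:
  assumes "symp E" and "matching_free E s S" and "(x, y) \<in> (edges_in E S)\<^sup>*"
  shows "\<exists>m < 3 * s. (x, y) \<in> edges_in E S ^^ m"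
proof -
  let ?R = "edges_in E S"
  define m where "m = (LEAST m. (x, y) \<in> ?R ^^ m)"
  have m: "(x, y) \<in> ?R ^^ m"
    unfolding m_def using assms(3) by (auto simp: rtrancl_power intro: LeastI)
  have least: "(x, y) \<notin> ?R ^^ k" if "k < m" for k
    using that unfolding m_def by (rule not_less_Least)
  from m obtain p where p: "p 0 = x" "p m = y" "\<And>i. i < m \<Longrightarrow> (p i, p (Suc i)) \<in> ?R"
    unfolding relpow_fun_conv by blast
  have far: "\<not> E (p a) (p b)" if "Suc a < b" "b \<le> m" for a b
  proof
    assume "E (p a) (p b)"
    moreover have "p a \<in> S" "p b \<in> S"
      using p(3)[of a] p(3)[of "b - 1"] that by (auto simp: edges_in_def)
    ultimately have "(p a, p b) \<in> ?R" by (simp add: edges_in_def)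
    moreover have "(x, p a) \<in> ?R ^^ a" "(p b, y) \<in> ?R ^^ (m - b)"
      using relpow_segment[of m p ?R 0 a, OF p(3)] relpow_segment[of m p ?R b m, OF p(3)] p(1,2) that by auto
    ultimately have "(x, y) \<in> (?R ^^ a O ?R) O ?R ^^ (m - b)" by blast
    then have "(x, y) \<in> ?R ^^ (Suc a + (m - b))" by (simp only: relpow.simps(2) relpow_add)
    moreover have "Suc a + (m - b) < m" using that by simp
    ultimately show False using least by blast
  qed
  have "m < 3 * s"
  proof (rule ccontr)
    assume "\<not> m < 3 * s"
    then have le': "3 * i + 1 \<le> m" "3 * i < m" if "i < s" for i using that by linarith+
    have nE: "\<not> E (p a) (p b)"
      if "i < s" "j < s" "i \<noteq> j" "a \<in> {3 * i, 3 * i + 1}" "b \<in> {3 * j, 3 * j + 1}" for a b i j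
    proof (cases "i < j")
      case True
      then have "Suc a < b" using that(4,5) by auto
      moreover have "b \<le> m" using that(5) le'[OF that(2)] by auto
      ultimately show ?thesis by (rule far)
    next
      case False
      then have "Suc b < a" using that(3-5) by auto
      moreover have "a \<le> m" using that(4) le'[OF that(1)] by auto
      ultimately show ?thesis using far sympD[OF assms(1)] by blast
    qed
    have "(\<lambda>i. p (3 * i)) ` {..<s} \<subseteq> S" "(\<lambda>i. p (3 * i + 1)) ` {..<s} \<subseteq> S"
      using p(3)[OF le'(2)] by (auto simp: edges_in_def)
    moreover have "induced_matching E s (\<lambda>i. p (3 * i)) (\<lambda>i. p (3 * i + 1))"
      unfolding induced_matching_def using nE p(3) le'(2) by (auto simp: edges_in_def)
    ultimately show False using assms(2) unfolding matching_free_def by blast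
  qed
  then show ?thesis using m by blast
qed

text \<open>Each member of a minimal dominating set has a private neighbour, which yields an induced matching.\<close>

lemma matching_free_dominating:
  assumes "symp E" and "finite A" and "independent E A" and "independent E Z"
    and "matching_free E s (A \<union> Z)"
  shows "\<exists>X \<subseteq> A. card X < s \<and> (\<forall>z \<in> Z. (\<exists>a \<in> A. E z a) \<longrightarrow> (\<exists>x \<in> X. E z x))"
proof -
  define Q where "Q = {X. X \<subseteq> A \<and> (\<forall>z \<in> Z. (\<exists>a \<in> A. E z a) \<longrightarrow> (\<exists>x \<in> X. E z x))}"
  have "finite Q" "A \<in> Q"
    using assms(2) by (auto simp: Q_def intro: finite_subset[of _ "Pow A"])
  from finite_has_minimal[OF this(1)] this(2)
  obtain X where X: "X \<in> Q" and min: "\<forall>Y \<in> Q. Y \<subseteq> X \<longrightarrow> X = Y" by blast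
  have XA: "X \<subseteq> A" using X by (simp add: Q_def)
  have "\<exists>z \<in> Z. E z x \<and> (\<forall>y \<in> X. y \<noteq> x \<longrightarrow> \<not> E z y)" if "x \<in> X" for x
  proof (rule ccontr)
    assume no: "\<not> ?thesis"
    have "X - {x} \<in> Q" unfolding Q_def
    proof (intro CollectI conjI ballI impI)
      fix z assume z: "z \<in> Z" "\<exists>a \<in> A. E z a"
      then obtain y where "y \<in> X" "E z y" using X by (auto simp: Q_def)
      then show "\<exists>y \<in> X - {x}. E z y" using no z(1) by (cases "y = x") auto
    qed (use XA in auto)
    then show False using min that by blast
  qed
  then obtain h where h: "\<And>x. x \<in> X \<Longrightarrow> h x \<in> Z \<and> E (h x) x \<and> (\<forall>y \<in> X. y \<noteq> x \<longrightarrow> \<not> E (h x) y)"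
    by metis
  have "card X < s"
  proof (rule ccontr)
    assume "\<not> card X < s"
    moreover have "finite X" using XA assms(2) by (rule finite_subset)
    ultimately obtain f where f: "bij_betw f {0..<card X} X" "s \<le> card X"
      using ex_bij_betw_nat_finite by fastforce
    have fX: "f i \<in> X" if "i < s" for i
      using f that by (auto dest!: bij_betwE)
    have finj: "f i \<noteq> f j" if "i < s" "j < s" "i \<noteq> j" for i j
      using f that by (auto simp: bij_betw_def dest: inj_onD)
    have "induced_matching E s f (\<lambda>i. h (f i))"
      unfolding induced_matching_def
    proof (intro conjI allI impI)
      fix i j assume ij: "i < s" "j < s" "i \<noteq> j"
      show "\<not> E (f i) (f j)" using assms(3) XA fX ij unfolding independent_def by blast
      show "\<not> E (f i) (h (f j))"
        using h[OF fX[OF ij(2)]] fX[OF ij(1)] finj[OF ij] sympD[OF assms(1)] by blast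
      show "\<not> E (h (f i)) (h (f j))" using assms(4) h fX ij unfolding independent_def by blast
    qed (use h fX sympD[OF assms(1)] in blast)
    moreover have "f ` {..<s} \<subseteq> A \<union> Z" "(\<lambda>i. h (f i)) ` {..<s} \<subseteq> A \<union> Z"
      using fX h XA by auto
    ultimately show False using assms(5) unfolding matching_free_def by blast
  qed
  then show ?thesis using X by (auto simp: Q_def)
qed

text \<open>Reachability is claimed inside \<open>P\<close> itself, so that every superset of
  \<open>P\<close> inherits it.\<close>

lemma walk_vertices:
  assumes "(c, d) \<in> edges_in E C ^^ m" and "c \<in> C"
  shows "\<exists>P \<subseteq> C. finite P \<and> card P \<le> Suc m \<and> c \<in> P \<and> d \<in> P \<and> (\<forall>y \<in> P. (c, y) \<in> (edges_in E P)\<^sup>*)"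
proof -
  obtain p where p: "p 0 = c" "p m = d" "\<And>i. i < m \<Longrightarrow> (p i, p (Suc i)) \<in> edges_in E C"
    using assms(1) unfolding relpow_fun_conv by blast
  let ?P = "p ` {..m}"
  have "(c, p i) \<in> (edges_in E ?P)\<^sup>*" if "i \<le> m" for i
    using that
  proof (induction i)
    case (Suc i)
    then have "(p i, p (Suc i)) \<in> edges_in E ?P" using p(3)[of i] by (auto simp: edges_in_def)
    then show ?case using Suc by (meson Suc_leD rtrancl.rtrancl_into_rtrancl)
  qed (simp add: p(1))
  moreover have "?P \<subseteq> C"
  proof
    fix y assume "y \<in> ?P"
    then obtain i where "i \<le> m" "y = p i" by auto
    then show "y \<in> C" using p(1) p(3)[of "i - 1"] assms(2) by (cases i) (auto simp: edges_in_def)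
  qed
  moreover have "card ?P \<le> Suc m" using card_image_le[of "{..m}" p] by simp
  moreover have "c \<in> ?P" "d \<in> ?P" using p by (auto intro: rev_image_eqI)
  ultimately show ?thesis by (intro exI[of _ ?P]) auto
qed

text \<open>The count in \<open>connected_extension\<close>: at most \<open>2 * s\<close> matched
  vertices, each reached from a fixed vertex by a walk on at most \<open>3 * s\<close> vertices, the
  fixed vertex itself, and two dominating sets of fewer than \<open>s\<close> vertices.\<close>

definition connector_bound :: "nat \<Rightarrow> nat" where
  "connector_bound s = 6 * s * s + 2 * s + 1"

text \<open>
  \<open>T\<close> is connected up by a maximal induced matching, paths linking its edges, and, for the vertices
  of \<open>T\<close> that still see none of these, small sets dominating them from \<open>A\<close> and from \<open>B\<close>.
\<close>

lemma connected_extension: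
  assumes "symp E" and "finite C" and "connected_in E C" and "matching_free E s C"
    and C: "C = T \<union> A \<union> B" and "independent E A" and "independent E B"
  shows "\<exists>S. T \<subseteq> S \<and> S \<subseteq> C \<and> connected_in E S \<and> card (S - T) \<le> connector_bound s"
proof (cases "C = {}")
  case True
  then show ?thesis using C by (intro exI[of _ "{}"]) (auto simp: connected_in_def)
next
  case False
  then obtain c where c: "c \<in> C" by blast
  \<comment> \<open>\<open>m\<close> is the size of a largest induced matching in \<open>C\<close>;
    the search starts from size 0, which is always attained.\<close>
  have "\<exists>m < s. \<not> matching_free E m C \<and> matching_free E (Suc m) C"
  proof (rule ccontr)
    assume no: "\<not> ?thesis"
    have "m \<le> s \<Longrightarrow> \<not> matching_free E m C" for m
    proof (induction m)
      case 0
      show ?case by (simp add: matching_free_def induced_matching_def)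
    next
      case (Suc m)
      then have "m < s" "\<not> matching_free E m C" by auto
      then show ?case using no by blast
    qed
    then show False using assms(4) by blast
  qed
  then obtain m where m: "m < s" "matching_free E (Suc m) C" and "\<not> matching_free E m C" by blast
  from this(3) obtain f g where
    fg: "f ` {..<m} \<subseteq> C" "g ` {..<m} \<subseteq> C" "induced_matching E m f g"
    unfolding matching_free_def by blast
  define D where "D = f ` {..<m} \<union> g ` {..<m}"
  have D: "finite D" "D \<subseteq> C" "card D \<le> 2 * m"
    using fg card_Un_le[of "f ` {..<m}" "g ` {..<m}"] card_image_le[of "{..<m}" f]
      card_image_le[of "{..<m}" g] by (auto simp: D_def)
  \<comment> \<open>An edge with neither end adjacent to \<open>D\<close> could be added to the
    matching.\<close>
  have dom: "\<exists>d \<in> D. E u d \<or> E v d" if "u \<in> C" "v \<in> C" "E u v" for u v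
  proof (rule ccontr)
    assume "\<not> ?thesis"
    then have "induced_matching E (Suc m) (f(m := u)) (g(m := v))"
      by (intro induced_matching_Suc assms fg that) (auto simp: D_def)
    moreover have "(f(m := u)) ` {..<Suc m} \<subseteq> C" "(g(m := v)) ` {..<Suc m} \<subseteq> C"
      using fg that by (auto simp: less_Suc_eq)
    ultimately show False using m(2) unfolding matching_free_def by blast
  qed
  have "\<exists>P \<subseteq> C. finite P \<and> card P \<le> 3 * s \<and> c \<in> P \<and> d \<in> P \<and> (\<forall>y \<in> P. (c, y) \<in> (edges_in E P)\<^sup>*)"
    if "d \<in> C" for d
  proof -
    have "(c, d) \<in> (edges_in E C)\<^sup>*" using assms(3) c that by (auto simp: connected_in_def)
    then obtain k where k: "k < 3 * s" "(c, d) \<in> edges_in E C ^^ k"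
      using matching_free_walk[OF assms(1,4)] by blast
    then show ?thesis using walk_vertices[OF k(2) c] by (meson Suc_leI order_trans)
  qed
  then obtain P where P: "\<And>d. d \<in> C \<Longrightarrow> P d \<subseteq> C \<and> finite (P d) \<and> card (P d) \<le> 3 * s \<and> c \<in> P d \<and>
      d \<in> P d \<and> (\<forall>y \<in> P d. (c, y) \<in> (edges_in E (P d))\<^sup>*)"
    by metis
  \<comment> \<open>\<open>c\<close> is added separately because \<open>D\<close> is empty if
    \<open>C\<close> spans no edge.\<close>
  define D' where "D' = insert c (\<Union>d \<in> D. P d)"
  have PD: "P d \<subseteq> C" "finite (P d)" "d \<in> P d" "card (P d) \<le> 3 * s" if "d \<in> D" for d
    using P[of d] D(2) that by blast+
  have D': "D \<subseteq> D'" "D' \<subseteq> C" "c \<in> D'" using PD(1,3) c by (auto simp: D'_def)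
  have "card (\<Union>d \<in> D. P d) \<le> (\<Sum>d \<in> D. card (P d))" using D(1) by (rule card_UN_le)
  also have "(\<Sum>d \<in> D. card (P d)) \<le> card D * (3 * s)"
    using sum_bounded_above[of D "\<lambda>d. card (P d)" "3 * s"] PD(4) by simp
  also have "\<dots> \<le> 2 * m * (3 * s)" using D(3) by (rule mult_le_mono1)
  also have "\<dots> \<le> 2 * s * (3 * s)" using m(1) by (intro mult_le_mono) auto
  finally have cD': "card D' \<le> 6 * s * s + 1"
    using D(1) PD(2) by (simp add: D'_def card_insert_if)
  have "finite D'" using D'(2) assms(2) by (rule finite_subset)
  define Z where "Z = {z \<in> T. z \<notin> D' \<and> (\<forall>d \<in> D'. \<not> E z d)}"
  have ZC: "Z \<subseteq> C" using C by (auto simp: Z_def)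
  \<comment> \<open>An edge inside \<open>Z\<close> would have an end adjacent to \<open>D\<close>,
    but \<open>Z\<close> avoids all neighbours of \<open>D'\<close>.\<close>
  have Z: "independent E Z"
    unfolding independent_def
  proof (intro ballI notI)
    fix u v assume uv: "u \<in> Z" "v \<in> Z" "E u v"
    then obtain d where "d \<in> D" "E u d \<or> E v d" using dom[of u v] ZC by blast
    then show False using D'(1) uv by (auto simp: Z_def)
  qed
  \<comment> \<open>As \<open>z\<close> has no neighbour in \<open>D\<close>, the edge
    \<open>zy\<close> must be dominated at \<open>y\<close>; hence a single vertex suffices to link
    \<open>z\<close> to \<open>D\<close>.\<close>
  have near: "\<exists>d \<in> D. E y d" if "E z y" "z \<in> Z" "y \<in> C" for y z
    using dom[of z y] that ZC D'(1) by (fastforce simp: Z_def)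
  \<comment> \<open>Discarding the members of \<open>F\<close> without neighbours in
    \<open>Z\<close> ensures, by \<open>near\<close>, that every chosen dominator is adjacent to
    \<open>D\<close>.\<close>
  have domin: "\<exists>X \<subseteq> F. card X < s \<and> (\<forall>x \<in> X. \<exists>d \<in> D. E x d) \<and>
      (\<forall>z \<in> Z. (\<exists>a \<in> F. E z a) \<longrightarrow> (\<exists>x \<in> X. E z x))"
    if F: "independent E F" "F \<subseteq> C" for F
  proof -
    let ?F = "{a \<in> F. \<exists>z \<in> Z. E z a}"
    have "\<exists>X \<subseteq> ?F. card X < s \<and> (\<forall>z \<in> Z. (\<exists>a \<in> ?F. E z a) \<longrightarrow> (\<exists>x \<in> X. E z x))"
    proof (rule matching_free_dominating)
      show "finite ?F" using F(2) assms(2) by (auto intro: finite_subset)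
      show "independent E ?F" using F(1) by (auto simp: independent_def)
      show "matching_free E s (?F \<union> Z)"
        using F(2) ZC by (intro matching_free_mono[OF assms(4)]) auto
    qed (use assms Z in auto)
    then obtain X where X: "X \<subseteq> ?F" "card X < s"
      "\<And>z. z \<in> Z \<Longrightarrow> \<exists>a \<in> ?F. E z a \<Longrightarrow> \<exists>x \<in> X. E z x" by blast
    have "\<forall>x \<in> X. \<exists>d \<in> D. E x d" using X(1) near F(2) by blast
    moreover have "\<forall>z \<in> Z. (\<exists>a \<in> F. E z a) \<longrightarrow> (\<exists>x \<in> X. E z x)" using X(3) by blast
    moreover have "X \<subseteq> F" using X(1) by blast
    ultimately show ?thesis using X(2) by blast
  qed
  have "A \<subseteq> C" "B \<subseteq> C" using C by auto
  from domin[OF assms(6) this(1)] obtain XA where XA: "XA \<subseteq> A" "card XA < s"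
    "\<And>x. x \<in> XA \<Longrightarrow> \<exists>d \<in> D. E x d" "\<And>z a. z \<in> Z \<Longrightarrow> a \<in> A \<Longrightarrow> E z a \<Longrightarrow> \<exists>x \<in> XA. E z x"
    by blast
  from domin[OF assms(7) \<open>B \<subseteq> C\<close>] obtain XB where XB: "XB \<subseteq> B" "card XB < s"
    "\<And>x. x \<in> XB \<Longrightarrow> \<exists>d \<in> D. E x d" "\<And>z a. z \<in> Z \<Longrightarrow> a \<in> B \<Longrightarrow> E z a \<Longrightarrow> \<exists>x \<in> XB. E z x"
    by blast
  define S where "S = T \<union> D' \<union> XA \<union> XB"
  have step: "(c, y) \<in> (edges_in E S)\<^sup>*" if "(c, x) \<in> (edges_in E S)\<^sup>*" "x \<in> S" "y \<in> S" "E y x" for x y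
  proof -
    have "(x, y) \<in> edges_in E S" using that sympD[OF assms(1)] by (auto simp: edges_in_def)
    with that(1) show ?thesis by (rule rtrancl_into_rtrancl)
  qed
  have reach1: "(c, y) \<in> (edges_in E S)\<^sup>*" if y: "y \<in> D'" for y
  proof (cases "y = c")
    case False
    then obtain d where d: "d \<in> D" "y \<in> P d" using y by (auto simp: D'_def)
    then have "(c, y) \<in> (edges_in E (P d))\<^sup>*" using P D(2) by blast
    moreover have "P d \<subseteq> S" using d(1) by (auto simp: S_def D'_def)
    ultimately show ?thesis by (rule edges_in_rtrancl_mono)
  qed simp
  have reach2: "(c, y) \<in> (edges_in E S)\<^sup>*" if y: "y \<in> S" "\<exists>d \<in> D'. E y d" for y
  proof -
    from y(2) obtain d where "d \<in> D'" "E y d" by blast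
    with reach1[of d] step[of d y] y(1) show ?thesis by (auto simp: S_def)
  qed
  have reach3: "(c, z) \<in> (edges_in E S)\<^sup>*" if z: "z \<in> Z" for z
  proof -
    have "z \<in> C" "z \<noteq> c" "z \<in> S" using z ZC D'(3) by (auto simp: Z_def S_def)
    then have "(z, c) \<in> (edges_in E C)\<^sup>*" using assms(3) c by (auto simp: connected_in_def)
    \<comment> \<open>Any neighbour of \<open>z\<close> in \<open>C\<close> will do: in
      \<open>T\<close> it already belongs to \<open>S\<close>, and in \<open>A\<close> or
      \<open>B\<close> it shows that \<open>z\<close> is dominated by \<open>XA\<close> or
      \<open>XB\<close>.\<close>
    then obtain y where "(z, y) \<in> edges_in E C" using \<open>z \<noteq> c\<close> by (metis converse_rtranclE)
    then have y: "y \<in> C" "E z y" by (auto simp: edges_in_def)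
    have "\<exists>x \<in> S. E z x \<and> (\<exists>d \<in> D'. E x d)"
    proof -
      consider "y \<in> T" | "y \<in> A" | "y \<in> B" using y(1) C by blast
      then show ?thesis
      proof cases
        case 1
        then show ?thesis using near[OF y(2) z y(1)] y(2) D'(1) unfolding S_def by blast
      next
        case 2
        from XA(4)[OF z this y(2)] XA(3) D'(1) show ?thesis unfolding S_def by blast
      next
        case 3
        from XB(4)[OF z this y(2)] XB(3) D'(1) show ?thesis unfolding S_def by blast
      qed
    qed
    then obtain x where "x \<in> S" "E z x" "\<exists>d \<in> D'. E x d" by blast
    then show ?thesis using step[of x z] reach2[of x] \<open>z \<in> S\<close> by blast
  qed
  have "(c, y) \<in> (edges_in E S)\<^sup>*" if y: "y \<in> S" for y
  proof -
    consider "y \<in> D'" | "\<exists>d \<in> D'. E y d" | "y \<in> Z"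
      using y XA(3) XB(3) D'(1) unfolding S_def Z_def by blast
    then show ?thesis using reach1 reach2[OF y] reach3 by cases auto
  qed
  then have "connected_in E S" by (rule connected_inI[OF assms(1)])
  moreover have "T \<subseteq> S" "S \<subseteq> C" using C D'(2) XA(1) XB(1) by (auto simp: S_def)
  moreover have "card (S - T) \<le> connector_bound s"
  proof -
    have fin: "finite XA" "finite XB"
      using finite_subset[OF subset_trans[OF XA(1) \<open>A \<subseteq> C\<close>] assms(2)]
        finite_subset[OF subset_trans[OF XB(1) \<open>B \<subseteq> C\<close>] assms(2)] by simp_all
    have "card (S - T) \<le> card (D' \<union> XA \<union> XB)"
      using fin \<open>finite D'\<close> by (intro card_mono) (auto simp: S_def)
    also have "\<dots> \<le> card D' + card XA + card XB"
      using card_Un_le[of "D' \<union> XA" XB] card_Un_le[of D' XA] by simp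
    finally show ?thesis using cD' XA(2) XB(2) by (simp add: connector_bound_def)
  qed
  ultimately show ?thesis by blast
qed

section \<open>Transversals and pairs of maximal independent sets\<close>

definition transversal :: "('a \<Rightarrow> 'a \<Rightarrow> bool) \<Rightarrow> 'a set \<Rightarrow> 'a set \<Rightarrow> bool" where
  "transversal E V S \<longleftrightarrow> S \<subseteq> V \<and>
     (\<exists>col :: 'a \<Rightarrow> bool. \<forall>x \<in> V - S. \<forall>y \<in> V - S. E x y \<longrightarrow> col x \<noteq> col y)"

lemma transversal_mono:
  assumes "transversal E V S" and "S \<subseteq> T" and "T \<subseteq> V"
  shows "transversal E V T"
proof -
  obtain col :: "'a \<Rightarrow> bool" where "\<forall>x \<in> V - S. \<forall>y \<in> V - S. E x y \<longrightarrow> col x \<noteq> col y"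
    using assms(1) unfolding transversal_def by auto
  moreover have "V - T \<subseteq> V - S" using assms(2) by blast
  ultimately show ?thesis using assms(3) unfolding transversal_def by (intro conjI exI[of _ col]) auto
qed

text \<open>Membership in \<open>A\<close> is a proper 2-colouring, since the remaining vertices
  outside \<open>A\<close> all lie in \<open>B\<close>.\<close>

lemma transversal_cover:
  assumes "maximal_independent E V A" and "maximal_independent E V B"
  shows "transversal E V (V - (A \<union> B))"
  unfolding transversal_def
  by (intro conjI exI[of _ "\<lambda>x. x \<in> A"])
    (use assms in \<open>auto simp: maximal_independent_def independent_def\<close>)

text \<open>Each colour class outside \<open>S\<close> extends to a maximal independent set of the
  whole graph. The extensions may overlap and absorb vertices of \<open>S\<close>, which only
  shrinks the transversal.\<close>

lemma transversal_reduce: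
  assumes "finite V" and "symp E" and "\<And>x. \<not> E x x" and "transversal E V S"
  shows "\<exists>A B. maximal_independent E V A \<and> maximal_independent E V B \<and> V - (A \<union> B) \<subseteq> S"
proof -
  obtain col :: "'a \<Rightarrow> bool" where col: "\<And>x y. x \<in> V - S \<Longrightarrow> y \<in> V - S \<Longrightarrow> E x y \<Longrightarrow> col x \<noteq> col y"
    using assms(4) unfolding transversal_def by blast
  have "\<exists>J. {x \<in> V - S. col x = b} \<subseteq> J \<and> maximal_independent E V J" for b
    by (rule independent_extend) (use assms col in \<open>auto simp: independent_def\<close>)
  then obtain J where J: "\<And>b. {x \<in> V - S. col x = b} \<subseteq> J b" "\<And>b. maximal_independent E V (J b)"
    by metis
  have "V - (J True \<union> J False) \<subseteq> S" using J(1)[of True] J(1)[of False] by auto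
  then show ?thesis using J(2) by blast
qed

text \<open>
  A smallest connected transversal \<open>S1\<close> contains some \<open>V - (A \<union> B)\<close>; extending the latter inside
  the component \<open>C\<close> of \<open>S1\<close> shows that \<open>S1\<close> is not much larger.
\<close>

lemma connected_transversal_reduce:
  assumes "finite V" and "symp E" and "\<And>x. \<not> E x x" and "matching_free E s V"
    and "transversal E V S" and "connected_in E S"
  shows "\<exists>A B D. maximal_independent E V A \<and> maximal_independent E V B \<and> D \<subseteq> V \<and>
    card D \<le> connector_bound s \<and> connected_in E (V - (A \<union> B) \<union> D) \<and>
    card (V - (A \<union> B) \<union> D) \<le> card S"
proof -
  define S1 where "S1 = arg_min card (\<lambda>S. transversal E V S \<and> connected_in E S)"
  have S1: "transversal E V S1" "connected_in E S1"
    using arg_min_natI[of "\<lambda>S. transversal E V S \<and> connected_in E S" S card] assms(5,6)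
    by (auto simp: S1_def)
  have min: "card S1 \<le> card S'" if "transversal E V S'" "connected_in E S'" for S'
    unfolding S1_def using that by (intro arg_min_nat_le) auto
  obtain A B where AB: "maximal_independent E V A" "maximal_independent E V B" "V - (A \<union> B) \<subseteq> S1"
    using transversal_reduce[OF assms(1-3) S1(1)] by blast
  let ?S0 = "V - (A \<union> B)"
  have fin: "finite S1" using S1(1) assms(1) by (auto simp: transversal_def intro: finite_subset)
  have "card (S1 - ?S0) \<le> connector_bound s"
  proof (cases "S1 = {}")
    case False
    then obtain x where x: "x \<in> S1" by blast
    \<comment> \<open>The component of \<open>x\<close> contains all of \<open>S1\<close>, and
      \<open>connected_extension\<close> needs a connected host set.\<close>
    define C where "C = {y \<in> V. (x, y) \<in> (edges_in E V)\<^sup>*}"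
    have CV: "C \<subseteq> V" unfolding C_def by blast
    have S1V: "S1 \<subseteq> V" using S1(1) by (simp add: transversal_def)
    have S1C: "S1 \<subseteq> C"
    proof
      fix y assume y: "y \<in> S1"
      then have "(x, y) \<in> (edges_in E S1)\<^sup>*" using x S1(2) by (auto simp: connected_in_def)
      then have "(x, y) \<in> (edges_in E V)\<^sup>*" using S1V by (rule edges_in_rtrancl_mono)
      then show "y \<in> C" using y S1V by (auto simp: C_def)
    qed
    have "(x, y) \<in> (edges_in E C)\<^sup>*" if "(x, y) \<in> (edges_in E V)\<^sup>*" for y
      using that
    proof (induction rule: rtrancl_induct)
      case (step y z)
      then have "(y, z) \<in> edges_in E C"
        by (auto simp: edges_in_def C_def intro: rtrancl_into_rtrancl)
      then show ?case using step.IH by (rule_tac rtrancl_into_rtrancl)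
    qed simp
    then have conn: "connected_in E C" by (intro connected_inI[OF assms(2), of _ x]) (simp add: C_def)
    have "?S0 \<subseteq> C" using AB(3) S1C by (rule subset_trans)
    then have split: "C = ?S0 \<union> (A \<inter> C) \<union> (B \<inter> C)" using CV by blast
    have indep: "independent E (A \<inter> C)" "independent E (B \<inter> C)"
      using AB(1,2) unfolding maximal_independent_def independent_def by blast+
    from connected_extension[OF assms(2) finite_subset[OF CV assms(1)] conn
        matching_free_mono[OF assms(4) CV] split indep]
    obtain S' where S': "?S0 \<subseteq> S'" "S' \<subseteq> C" "connected_in E S'" "card (S' - ?S0) \<le> connector_bound s"
      by (elim exE conjE) (rule that)
    have S'V: "S' \<subseteq> V" using S'(2) CV by (rule subset_trans)
    then have "transversal E V S'"
      by (rule transversal_mono[OF transversal_cover[OF AB(1,2)] S'(1)])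
    \<comment> \<open>\<open>?S0\<close> is contained in both \<open>S1\<close> and
      \<open>S'\<close>, so minimality of \<open>S1\<close> bounds its surplus over
      \<open>?S0\<close> by that of \<open>S'\<close>.\<close>
    from min[OF this S'(3)] have "card S1 - card ?S0 \<le> card S' - card ?S0" by simp
    moreover have "finite S'" "finite ?S0" using S'V assms(1) by (auto intro: finite_subset)
    ultimately show ?thesis
      using S'(1,4) AB(3) fin by (simp add: card_Diff_subset)
  qed simp
  moreover have "?S0 \<union> (S1 - ?S0) = S1" using AB(3) by blast
  moreover have "S1 - ?S0 \<subseteq> V" using S1(1) by (auto simp: transversal_def)
  ultimately show ?thesis using AB(1,2) S1(2) min[OF assms(5,6)]
    by (intro exI[of _ A] exI[of _ B] exI[of _ "S1 - ?S0"]) simp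
qed


section \<open>Passing to vertex indices\<close>

text \<open>The order is the one in which \<open>encode\<close> lists the rows, so a machine reading
  the matrix sees exactly these indices.\<close>

definition vertex :: "nat pair_pre_digraph \<Rightarrow> nat \<Rightarrow> nat" where
  "vertex G i = sorted_list_of_set (pverts G) ! i"

definition order_of :: "nat pair_pre_digraph \<Rightarrow> nat" where
  "order_of G = card (pverts G)"

definition adj :: "nat pair_pre_digraph \<Rightarrow> nat \<Rightarrow> nat \<Rightarrow> bool" where
  "adj G i j \<longleftrightarrow> i < order_of G \<and> j < order_of G \<and> (vertex G i, vertex G j) \<in> parcs G"

lemma odd_cycle_transversal_iff:
  "odd_cycle_transversal G S \<longleftrightarrow> transversal (\<lambda>u v. (u, v) \<in> parcs G) (pverts G) S"
proof
  assume "odd_cycle_transversal G S"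
  then have S: "S \<subseteq> pverts G" and "bipartite (with_proj G \<restriction> (pverts G - S))"
    by (simp_all add: odd_cycle_transversal_def)
  from this(2) obtain A B where AB: "A \<inter> B = {}"
    "\<forall>e \<in> {e \<in> parcs G. fst e \<in> pverts G - S \<and> snd e \<in> pverts G - S}.
      fst e \<in> A \<and> snd e \<in> B \<or> fst e \<in> B \<and> snd e \<in> A"
    unfolding bipartite_def by auto
  show "transversal (\<lambda>u v. (u, v) \<in> parcs G) (pverts G) S"
    unfolding transversal_def
  proof (intro conjI exI[of _ "\<lambda>x. x \<in> A"] ballI impI)
    fix u v assume "u \<in> pverts G - S" "v \<in> pverts G - S" "(u, v) \<in> parcs G"
    with bspec[OF AB(2), of "(u, v)"] AB(1) show "(u \<in> A) \<noteq> (v \<in> A)" by auto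
  qed (rule S)
next
  assume "transversal (\<lambda>u v. (u, v) \<in> parcs G) (pverts G) S"
  then obtain col :: "'a \<Rightarrow> bool" where S: "S \<subseteq> pverts G"
    and col: "\<forall>u \<in> pverts G - S. \<forall>v \<in> pverts G - S. (u, v) \<in> parcs G \<longrightarrow> col u \<noteq> col v"
    unfolding transversal_def by blast
  have "bipartite (with_proj G \<restriction> (pverts G - S))"
    unfolding bipartite_def
    by (intro exI[of _ "{u \<in> pverts G - S. col u}"] exI[of _ "{u \<in> pverts G - S. \<not> col u}"])
      (use col in auto)
  then show "odd_cycle_transversal G S" using S by (simp add: odd_cycle_transversal_def)
qed

lemma rtrancl_on_eq:
  assumes "r \<subseteq> S \<times> S" and "x \<in> S"
  shows "(x, y) \<in> rtrancl_on S r \<longleftrightarrow> (x, y) \<in> r\<^sup>*"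
proof
  assume "(x, y) \<in> r\<^sup>*"
  then show "(x, y) \<in> rtrancl_on S r"
    by (induction rule: rtrancl_induct) (use assms in \<open>auto intro: rtrancl_on_into_rtrancl_on\<close>)
qed (rule rtrancl_on_rtranclI)

text \<open>The library notion passes to the symmetric closure, which adds no arcs here, and is
  false on the empty vertex set.\<close>

lemma connected_induced_iff:
  assumes "pair_graph G"
  shows "connected (with_proj G \<restriction> S) \<longleftrightarrow> S \<noteq> {} \<and> connected_in (\<lambda>u v. (u, v) \<in> parcs G) S"
proof -
  interpret pair_graph G by fact
  have "parcs (mk_symmetric (with_proj G \<restriction> S)) = edges_in (\<lambda>u v. (u, v) \<in> parcs G) S"
    by (auto simp: parcs_mk_symmetric edges_in_def intro: arcs_symmetric)
  moreover have "edges_in (\<lambda>u v. (u, v) \<in> parcs G) S \<subseteq> S \<times> S" by (auto simp: edges_in_def)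
  ultimately show ?thesis
    unfolding connected_def strongly_connected_def reachable_def connected_in_def
    by (simp add: rtrancl_on_eq)
qed

lemma transversal_image:
  assumes "inj_on \<phi> V" and "S \<subseteq> V" and "\<And>x y. x \<in> V \<Longrightarrow> y \<in> V \<Longrightarrow> E x y \<longleftrightarrow> E' (\<phi> x) (\<phi> y)"
  shows "transversal E' (\<phi> ` V) (\<phi> ` S) \<longleftrightarrow> transversal E V S"
proof -
  have diff: "\<phi> ` V - \<phi> ` S = \<phi> ` (V - S)" 
    using inj_on_image_set_diff[OF assms(1), of V S] assms(2) by simp
  show ?thesis
  proof
    assume "transversal E' (\<phi> ` V) (\<phi> ` S)"
    then obtain col :: "'b \<Rightarrow> bool" where
      "\<forall>x \<in> \<phi> ` V - \<phi> ` S. \<forall>y \<in> \<phi> ` V - \<phi> ` S. E' x y \<longrightarrow> col x \<noteq> col y"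
      unfolding transversal_def by blast
    then show "transversal E V S" unfolding transversal_def diff
      by (intro conjI exI[of _ "col \<circ> \<phi>"]) (use assms in auto)
  next
    assume "transversal E V S"
    then obtain col :: "'a \<Rightarrow> bool" where
      "\<forall>x \<in> V - S. \<forall>y \<in> V - S. E x y \<longrightarrow> col x \<noteq> col y"
      unfolding transversal_def by blast
    then show "transversal E' (\<phi> ` V) (\<phi> ` S)" unfolding transversal_def diff
      by (intro conjI exI[of _ "col \<circ> inv_into V \<phi>"]) (use assms in auto)
  qed
qed

lemma rtrancl_map:
  assumes "\<And>x y. (x, y) \<in> R \<Longrightarrow> (\<phi> x, \<phi> y) \<in> R'" and "(x, y) \<in> R\<^sup>*"
  shows "(\<phi> x, \<phi> y) \<in> R'\<^sup>*"
  using assms(2) by (induction rule: rtrancl_induct) (auto intro: rtrancl_into_rtrancl assms(1))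

lemma connected_in_image:
  assumes "inj_on \<phi> S" and "\<And>x y. x \<in> S \<Longrightarrow> y \<in> S \<Longrightarrow> E x y \<longleftrightarrow> E' (\<phi> x) (\<phi> y)"
  shows "connected_in E' (\<phi> ` S) \<longleftrightarrow> connected_in E S"
proof -
  have 1: "(\<phi> x, \<phi> y) \<in> (edges_in E' (\<phi> ` S))\<^sup>*" if "(x, y) \<in> (edges_in E S)\<^sup>*" for x y
    by (rule rtrancl_map[OF _ that]) (use assms in \<open>auto simp: edges_in_def\<close>)
  have 2: "(inv_into S \<phi> x, inv_into S \<phi> y) \<in> (edges_in E S)\<^sup>*"
    if "(x, y) \<in> (edges_in E' (\<phi> ` S))\<^sup>*" for x y
    by (rule rtrancl_map[OF _ that]) (use assms in \<open>auto simp: edges_in_def\<close>)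
  have "(x, y) \<in> (edges_in E S)\<^sup>* \<longleftrightarrow> (\<phi> x, \<phi> y) \<in> (edges_in E' (\<phi> ` S))\<^sup>*"
    if "x \<in> S" "y \<in> S" for x y
    using 1 2[of "\<phi> x" "\<phi> y"] that assms(1) by auto
  then show ?thesis unfolding connected_in_def by simp
qed

context
  fixes G :: "nat pair_pre_digraph"
  assumes G: "pair_graph G"
begin

interpretation pair_graph G by (rule G)

lemma vertex_bij: "bij_betw (vertex G) {..<order_of G} (pverts G)"
  unfolding vertex_def order_of_def
  using bij_betw_nth[of "sorted_list_of_set (pverts G)" "{..<card (pverts G)}" "pverts G"]
    finite_verts by simp

lemma adj_symp: "symp (adj G)"
  by (rule sympI) (auto simp: adj_def intro: arcs_symmetric)

lemma adj_irrefl: "\<not> adj G i i"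
  by (auto simp: adj_def dest: no_loops)

lemma transversal_adj:
  assumes "S \<subseteq> {..<order_of G}"
  shows "odd_cycle_transversal G (vertex G ` S) \<longleftrightarrow> transversal (adj G) {..<order_of G} S"
  using transversal_image[of "vertex G" "{..<order_of G}" S "adj G" "\<lambda>u v. (u, v) \<in> parcs G"]
    vertex_bij assms by (simp add: odd_cycle_transversal_iff bij_betw_def adj_def)

lemma connected_adj:
  assumes "S \<subseteq> {..<order_of G}"
  shows "S = {} \<or> connected (with_proj G \<restriction> (vertex G ` S)) \<longleftrightarrow> connected_in (adj G) S"
proof -
  have "connected_in (\<lambda>u v. (u, v) \<in> parcs G) (vertex G ` S) \<longleftrightarrow> connected_in (adj G) S"
    by (rule connected_in_image) (use vertex_bij assms in \<open>auto simp: bij_betw_def adj_def intro: inj_on_subset\<close>)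
  then show ?thesis by (auto simp: connected_induced_iff[OF G] connected_in_def)
qed

text \<open>The cardinality is a separate argument of \<open>P\<close> because passing to indices
  changes the set but not its size.\<close>

lemma ex_vertex_image:
  "(\<exists>S. S \<subseteq> pverts G \<and> P S (card S)) \<longleftrightarrow>
   (\<exists>S. S \<subseteq> {..<order_of G} \<and> P (vertex G ` S) (card S))"
proof
  assume "\<exists>S. S \<subseteq> pverts G \<and> P S (card S)"
  then obtain S where S: "S \<subseteq> pverts G" "P S (card S)" by blast
  then have "S \<subseteq> vertex G ` {..<order_of G}" using vertex_bij by (simp add: bij_betw_def)
  then obtain T where T: "T \<subseteq> {..<order_of G}" "S = vertex G ` T" by (rule subset_imageE)
  then have "card S = card T"
    using vertex_bij by (auto simp: bij_betw_def intro!: card_image intro: inj_on_subset)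
  then show "\<exists>S. S \<subseteq> {..<order_of G} \<and> P (vertex G ` S) (card S)" using S T by auto
next
  assume "\<exists>S. S \<subseteq> {..<order_of G} \<and> P (vertex G ` S) (card S)"
  then obtain T where T: "T \<subseteq> {..<order_of G}" "P (vertex G ` T) (card T)" by blast
  then have "card (vertex G ` T) = card T"
    using vertex_bij by (auto simp: bij_betw_def intro!: card_image intro: inj_on_subset)
  moreover have "vertex G ` T \<subseteq> pverts G" using T(1) vertex_bij by (auto simp: bij_betw_def)
  ultimately show "\<exists>S. S \<subseteq> pverts G \<and> P S (card S)" using T(2) by metis
qed

lemma odd_cycle_transversal_adj:
  "(G, k) \<in> odd_cycle_transversal_problem \<longleftrightarrow>
     (\<exists>S. transversal (adj G) {..<order_of G} S \<and> int (card S) \<le> k)"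
proof -
  have "(G, k) \<in> odd_cycle_transversal_problem \<longleftrightarrow>
    (\<exists>S. S \<subseteq> pverts G \<and> odd_cycle_transversal G S \<and> int (card S) \<le> k)"
    by (auto simp: odd_cycle_transversal_problem_def odd_cycle_transversal_def)
  also have "\<dots> \<longleftrightarrow> (\<exists>S. S \<subseteq> {..<order_of G} \<and> odd_cycle_transversal G (vertex G ` S) \<and> int (card S) \<le> k)"
    using ex_vertex_image[of "\<lambda>S c. odd_cycle_transversal G S \<and> int c \<le> k"] by simp
  also have "\<dots> \<longleftrightarrow> (\<exists>S. transversal (adj G) {..<order_of G} S \<and> int (card S) \<le> k)"
  proof (intro iff_exI)
    fix S
    show "(S \<subseteq> {..<order_of G} \<and> odd_cycle_transversal G (vertex G ` S) \<and> int (card S) \<le> k) \<longleftrightarrow>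
      (transversal (adj G) {..<order_of G} S \<and> int (card S) \<le> k)"
    proof (cases "S \<subseteq> {..<order_of G}")
      case True
      then show ?thesis using transversal_adj[OF True] by simp
    next
      case False
      then show ?thesis by (simp add: transversal_def)
    qed
  qed
  finally show ?thesis .
qed

lemma connected_odd_cycle_transversal_adj:
  "(G, k) \<in> connected_odd_cycle_transversal_problem \<longleftrightarrow>
     (\<exists>S. transversal (adj G) {..<order_of G} S \<and> connected_in (adj G) S \<and> int (card S) \<le> k)"
proof -
  have "(G, k) \<in> connected_odd_cycle_transversal_problem \<longleftrightarrow>
    (\<exists>S. S \<subseteq> pverts G \<and> odd_cycle_transversal G S \<and> (S = {} \<or> connected (with_proj G \<restriction> S)) \<and>
      int (card S) \<le> k)"
    by (auto simp: connected_odd_cycle_transversal_problem_def connected_odd_cycle_transversal_def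
        odd_cycle_transversal_def)
  also have "\<dots> \<longleftrightarrow> (\<exists>S. S \<subseteq> {..<order_of G} \<and> odd_cycle_transversal G (vertex G ` S) \<and>
      (vertex G ` S = {} \<or> connected (with_proj G \<restriction> (vertex G ` S))) \<and> int (card S) \<le> k)"
    using ex_vertex_image[of "\<lambda>S c. odd_cycle_transversal G S \<and>
      (S = {} \<or> connected (with_proj G \<restriction> S)) \<and> int c \<le> k"] by simp
  also have "\<dots> \<longleftrightarrow> (\<exists>S. transversal (adj G) {..<order_of G} S \<and> connected_in (adj G) S \<and> int (card S) \<le> k)"
  proof (intro iff_exI)
    fix S
    show "(S \<subseteq> {..<order_of G} \<and> odd_cycle_transversal G (vertex G ` S) \<and>
      (vertex G ` S = {} \<or> connected (with_proj G \<restriction> (vertex G ` S))) \<and> int (card S) \<le> k) \<longleftrightarrow>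
      (transversal (adj G) {..<order_of G} S \<and> connected_in (adj G) S \<and> int (card S) \<le> k)"
    proof (cases "S \<subseteq> {..<order_of G}")
      case True
      then show ?thesis using transversal_adj[OF True] connected_adj[OF True] by simp
    next
      case False
      then show ?thesis by (simp add: transversal_def)
    qed
  qed
  finally show ?thesis .
qed

text \<open>Pair \<open>i\<close> of an induced matching serves as the image of copy
  \<open>i\<close> of the path, which yields an induced copy of the forbidden graph.\<close>

lemma matching_free_adj:
  assumes "induced_free (disjoint_copies s (path_graph 2)) G"
  shows "matching_free (adj G) s {..<order_of G}"
  unfolding matching_free_def
proof (rule notI, elim exE conjE)
  fix f g assume m: "induced_matching (adj G) s f g"
  let ?F = "disjoint_copies s (path_graph 2)"
  define h where "h = (\<lambda>(i, j :: nat). vertex G (if j = 0 then f i else g i))"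
  define hom where "hom = \<lparr>iso_verts = h, iso_arcs = (\<lambda>(p, q). (h p, h q)), iso_head = snd, iso_tail = fst\<rparr>"
  have verts: "pverts ?F = {0..<s} \<times> {0, 1}"
    by (auto simp: disjoint_copies_def path_graph_def)
  have arcs: "parcs ?F = (\<Union>i \<in> {0..<s}. {((i, 0), (i, 1)), ((i, 1), (i, 0))})"
    by (auto simp: disjoint_copies_def path_graph_def)
  have pos: "f i < order_of G" "g i < order_of G" "adj G (f i) (g i)" "adj G (g i) (f i)" if "i < s" for i
    using m that sympD[OF adj_symp] by (auto simp: induced_matching_def adj_def)
  have neg: "\<not> adj G (f i) (f j)" "\<not> adj G (g i) (g j)" "\<not> adj G (f i) (g j)" "\<not> adj G (g i) (f j)"
    if "i < s" "j < s" "i \<noteq> j" for i j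
    using m that sympD[OF adj_symp] unfolding induced_matching_def by blast+
  have arc_iff: "(h (i, a), h (j, b)) \<in> parcs G \<longleftrightarrow> i = j \<and> a \<noteq> b"
    if "i < s" "j < s" "a \<in> {0, 1}" "b \<in> {0, 1}" for i j a b
    using that pos[of i] pos[of j] neg[of i j] adj_irrefl by (auto simp: h_def adj_def)
  have "inj_on h (pverts ?F)"
  proof (rule inj_onI)
    fix p q assume pq: "p \<in> pverts ?F" "q \<in> pverts ?F" "h p = h q"
    obtain i a j b where *: "p = (i, a)" "q = (j, b)" "i < s" "j < s" "a \<in> {0, 1}" "b \<in> {0, 1}"
      using pq(1,2) unfolding verts by auto
    \<comment> \<open>Injectivity comes from adjacency: the partner of \<open>p\<close> in its copy
      is adjacent to the common image, and \<open>arc_iff\<close> then forces \<open>q\<close> to be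
      \<open>p\<close>.\<close>
    have "(h (i, a), h (i, 1 - a)) \<in> parcs G" using arc_iff[of i i a "1 - a"] * by auto
    then have "(h (j, b), h (i, 1 - a)) \<in> parcs G" using pq(3) * by simp
    then have "j = i \<and> b \<noteq> 1 - a" using arc_iff[of j i b "1 - a"] * by auto
    then show "p = q" using * by auto
  qed
  moreover have "inj_on (\<lambda>(p, q). (h p, h q)) (parcs ?F)"
  proof (rule inj_on_subset)
    show "inj_on (\<lambda>(p, q). (h p, h q)) (pverts ?F \<times> pverts ?F)"
      using \<open>inj_on h (pverts ?F)\<close> by (auto simp: inj_on_def)
    show "parcs ?F \<subseteq> pverts ?F \<times> pverts ?F" by (auto simp: verts arcs)
  qed
  moreover have "wf_digraph (with_proj ?F)"
    by unfold_locales (auto simp: verts arcs)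
  ultimately have iso: "pre_digraph.digraph_isomorphism (with_proj ?F) hom"
    unfolding pre_digraph.digraph_isomorphism_def by (auto simp: hom_def)
  have hV: "h ` pverts ?F \<subseteq> pverts G"
    using pos vertex_bij by (auto simp: verts h_def bij_betw_def)
  have "{e \<in> parcs G. fst e \<in> h ` pverts ?F \<and> snd e \<in> h ` pverts ?F} = (\<lambda>(p, q). (h p, h q)) ` parcs ?F"
  proof (intro equalityI subsetI)
    fix e assume "e \<in> {e \<in> parcs G. fst e \<in> h ` pverts ?F \<and> snd e \<in> h ` pverts ?F}"
    then obtain i a j b where *: "e = (h (i, a), h (j, b))" "e \<in> parcs G" "i < s" "j < s"
      "a \<in> {0, 1}" "b \<in> {0, 1}"
      unfolding verts by (cases e) auto
    then have "i = j \<and> a \<noteq> b" using arc_iff[of i j a b] by simp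
    then have "((i, a), (j, b)) \<in> parcs ?F" using * by (auto simp: arcs)
    then show "e \<in> (\<lambda>(p, q). (h p, h q)) ` parcs ?F" using *(1) by (auto intro: rev_image_eqI)
  next
    fix e assume "e \<in> (\<lambda>(p, q). (h p, h q)) ` parcs ?F"
    then obtain i where i: "i < s" and "e = (h (i, 0), h (i, 1)) \<or> e = (h (i, 1), h (i, 0))"
      unfolding arcs by auto
    then show "e \<in> {e \<in> parcs G. fst e \<in> h ` pverts ?F \<and> snd e \<in> h ` pverts ?F}"
      using arc_iff[OF i i, of 0 1] arc_iff[OF i i, of 1 0] by (auto simp: verts)
  qed
  then have "with_proj G \<restriction> (h ` pverts ?F) = app_iso hom (with_proj ?F)"
    by (simp add: induce_subgraph_def app_iso_def hom_def)
  then have "digraph_iso (with_proj ?F) (with_proj G \<restriction> (h ` pverts ?F))"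
    using iso unfolding digraph_iso_def by blast
  moreover have "induced_subgraph (with_proj G \<restriction> (h ` pverts ?F)) (with_proj G)"
    using hV by (rule induced_induce)
  ultimately show False using assms unfolding induced_free_def by blast
qed

end


section \<open>The algorithm as a formula\<close>

definition F_or :: "fm \<Rightarrow> fm \<Rightarrow> fm" where
  "F_or \<phi> \<psi> = FNot (FAnd (FNot \<phi>) (FNot \<psi>))"

definition F_true :: fm where
  "F_true = FLess (Num 0) (Num 1)"

definition F_eq :: "aexp \<Rightarrow> aexp \<Rightarrow> fm" where
  "F_eq a b = FAnd (FNot (FLess a b)) (FNot (FLess b a))"

definition F_in :: "aexp \<Rightarrow> nat \<Rightarrow> fm" where
  "F_in e a = FLess (Num 0) (Get a e)"

primrec F_any :: "nat \<Rightarrow> (nat \<Rightarrow> fm) \<Rightarrow> fm" where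
  "F_any 0 \<phi> = FNot F_true"
| "F_any (Suc m) \<phi> = F_or (F_any m \<phi>) (\<phi> m)"

text \<open>\<open>m\<close> is fixed by the program, so nesting \<open>m\<close> quantifiers stays
  polynomial, with a degree that grows with \<open>m\<close>. The entries range up to the input
  length, beyond the vertex indices.\<close>

primrec F_tuple :: "nat \<Rightarrow> fm \<Rightarrow> fm" where
  "F_tuple 0 \<phi> = \<phi>"
| "F_tuple (Suc m) \<phi> = FEx (Reg 0) (F_tuple m \<phi>)"

lemma F_basic [simp]:
  "fval (F_or \<phi> \<psi>) d \<sigma> \<longleftrightarrow> fval \<phi> d \<sigma> \<or> fval \<psi> d \<sigma>"
  "fval F_true d \<sigma>"
  "fval (F_eq a b) d \<sigma> \<longleftrightarrow> aval a \<sigma> = aval b \<sigma>"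
  "fval (F_in e j) d \<sigma> \<longleftrightarrow> 0 < snd \<sigma> j (aval e \<sigma>)"
  "wf_fm (F_or \<phi> \<psi>) d \<longleftrightarrow> wf_fm \<phi> d \<and> wf_fm \<psi> d"
  "wf_fm F_true d"
  "wf_fm (F_eq a b) d \<longleftrightarrow> wfa d a \<and> wfa d b"
  "wf_fm (F_in e j) d \<longleftrightarrow> j < d \<and> wfa d e"
  by (auto simp: F_or_def F_true_def F_eq_def F_in_def)

lemma F_any [simp]: "fval (F_any m \<phi>) d \<sigma> \<longleftrightarrow> (\<exists>i < m. fval (\<phi> i) d \<sigma>)"
  by (induction m) (auto simp: less_Suc_eq)

lemma wf_F_any [simp]: "wf_fm (F_any m \<phi>) d \<longleftrightarrow> (\<forall>i < m. wf_fm (\<phi> i) d)"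
  by (induction m) (auto simp: less_Suc_eq)

definition set_regs :: "nat \<Rightarrow> nat \<Rightarrow> (nat \<Rightarrow> nat) \<Rightarrow> state \<Rightarrow> state" where
  "set_regs d m t \<sigma> = ((\<lambda>r. if d \<le> r \<and> r < d + m then t (r - d) else fst \<sigma> r), snd \<sigma>)"

lemma F_tuple:
  assumes "0 < d"
  shows "fval (F_tuple m \<phi>) d \<sigma> \<longleftrightarrow>
    (\<exists>t. (\<forall>i < m. t i < fst \<sigma> 0) \<and> fval \<phi> (d + m) (set_regs d m t \<sigma>))"
  using assms
proof (induction m arbitrary: d \<sigma>)
  case 0
  have "set_regs d 0 t \<sigma> = \<sigma>" for t by (auto simp: set_regs_def prod_eq_iff fun_eq_iff)
  then show ?case by simp
next
  case (Suc m)
  have eq: "set_regs (Suc d) m t (set_reg d x \<sigma>) = set_regs d (Suc m) (case_nat x t) \<sigma>" for t x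
  proof -
    have "case_nat x t (r - d) = (if r = d then x else t (r - Suc d))" if "d \<le> r" for r
      using that Suc_diff_Suc[of d r] by (cases "r = d") (auto split: nat.split)
    then show ?thesis by (auto simp: set_regs_def fun_eq_iff prod_eq_iff)
  qed
  have "fval (F_tuple (Suc m) \<phi>) d \<sigma> \<longleftrightarrow> (\<exists>x t. x < fst \<sigma> 0 \<and> (\<forall>i < m. t i < fst \<sigma> 0) \<and>
      fval \<phi> (d + Suc m) (set_regs d (Suc m) (case_nat x t) \<sigma>))"
    using Suc.prems by (auto simp: Suc.IH bound_def eq)
  also have "\<dots> \<longleftrightarrow> (\<exists>t. (\<forall>i < Suc m. t i < fst \<sigma> 0) \<and> fval \<phi> (d + Suc m) (set_regs d (Suc m) t \<sigma>))"
  proof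
    assume "\<exists>x t. x < fst \<sigma> 0 \<and> (\<forall>i < m. t i < fst \<sigma> 0) \<and>
      fval \<phi> (d + Suc m) (set_regs d (Suc m) (case_nat x t) \<sigma>)"
    then obtain x t where *: "x < fst \<sigma> 0" "\<forall>i < m. t i < fst \<sigma> 0"
      "fval \<phi> (d + Suc m) (set_regs d (Suc m) (case_nat x t) \<sigma>)" by auto
    then have "\<forall>i < Suc m. case_nat x t i < fst \<sigma> 0" by (auto split: nat.split)
    then show "\<exists>t. (\<forall>i < Suc m. t i < fst \<sigma> 0) \<and> fval \<phi> (d + Suc m) (set_regs d (Suc m) t \<sigma>)"
      using *(3) by blast
  next
    assume "\<exists>t. (\<forall>i < Suc m. t i < fst \<sigma> 0) \<and> fval \<phi> (d + Suc m) (set_regs d (Suc m) t \<sigma>)"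
    then obtain t where *: "\<forall>i < Suc m. t i < fst \<sigma> 0"
      "fval \<phi> (d + Suc m) (set_regs d (Suc m) t \<sigma>)" by auto
    have "case_nat (t 0) (\<lambda>i. t (Suc i)) = t" by (auto simp: fun_eq_iff split: nat.split)
    then show "\<exists>x t. x < fst \<sigma> 0 \<and> (\<forall>i < m. t i < fst \<sigma> 0) \<and>
      fval \<phi> (d + Suc m) (set_regs d (Suc m) (case_nat x t) \<sigma>)"
      using * by (intro exI[of _ "t 0"] exI[of _ "\<lambda>i. t (Suc i)"]) auto
  qed
  finally show ?case .
qed

lemma wf_F_tuple [simp]: "0 < d \<Longrightarrow> wf_fm (F_tuple m \<phi>) d \<longleftrightarrow> wf_fm \<phi> (d + m)"
  by (induction m arbitrary: d) auto

lemma fill_cong: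
  assumes "\<And>v f. v < m \<Longrightarrow> P v f \<longleftrightarrow> Q v f"
  shows "fill P m = fill Q m"
  using assms by (induction m) auto

lemma iterate_add: "iterate (\<lambda>m x. x + c) a k = a + k * (c :: nat)"
  by (induction k) auto

lemma iterate_sum: "iterate (\<lambda>m x. x + f m) a k = a + (\<Sum>i < k. f i :: nat)"
  by (induction k) auto

text \<open>Register \<open>3\<close> holds the number of vertices.\<close>

definition graph_state :: "nat \<Rightarrow> (nat \<Rightarrow> nat) \<Rightarrow> state \<Rightarrow> bool" where
  "graph_state n w \<sigma> \<longleftrightarrow> fst \<sigma> 3 = n \<and> snd \<sigma> 0 = w \<and> n \<le> fst \<sigma> 0"

definition bit_adj :: "nat \<Rightarrow> (nat \<Rightarrow> nat) \<Rightarrow> nat \<Rightarrow> nat \<Rightarrow> bool" where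
  "bit_adj n w x y \<longleftrightarrow> x < n \<and> y < n \<and> 0 < w (n + 1 + x * n + y)"

text \<open>The machine cannot multiply; starting from \<open>n + 1\<close> and adding
  \<open>n\<close> in each of \<open>x\<close> rounds reaches row \<open>x\<close> of the matrix.
  The guard \<open>x < n\<close> ensures that the cut-off at the input length does not shorten the
  iteration.\<close>

definition F_adj :: "nat \<Rightarrow> aexp \<Rightarrow> aexp \<Rightarrow> fm" where
  "F_adj d x y = FAnd (FLess x (Reg 3)) (FAnd (FLess y (Reg 3))
     (FIter x (Plus (Reg 3) (Num 1)) (Plus (Reg d) (Reg 3)) (F_in (Plus (Reg d) y) 0)))"

lemma graph_state_upd [simp]:
  "d \<ge> 4 \<Longrightarrow> graph_state n w (set_reg d i \<sigma>) \<longleftrightarrow> graph_state n w \<sigma>"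
  "d \<ge> 4 \<Longrightarrow> graph_state n w (set_arr d f \<sigma>) \<longleftrightarrow> graph_state n w \<sigma>"
  "d \<ge> 4 \<Longrightarrow> graph_state n w (set_regs d m t \<sigma>) \<longleftrightarrow> graph_state n w \<sigma>"
  by (auto simp: graph_state_def set_regs_def)

lemma aval_set_reg: "wfa d e \<Longrightarrow> aval e (set_reg d i \<sigma>) = aval e \<sigma>"
  by (induction e) auto

lemma F_adj:
  assumes "graph_state n w \<sigma>" and "d \<ge> 4" and "wfa d y"
  shows "fval (F_adj d x y) d \<sigma> \<longleftrightarrow> bit_adj n w (aval x \<sigma>) (aval y \<sigma>)"
proof (cases "aval x \<sigma> < n")
  case True
  then have "bound x \<sigma> = aval x \<sigma>" using assms by (simp add: bound_def graph_state_def)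
  then show ?thesis using assms True
    by (simp add: F_adj_def bit_adj_def graph_state_def iterate_add aval_set_reg)
qed (use assms in \<open>simp add: F_adj_def bit_adj_def graph_state_def\<close>)

lemma wfa_Suc: "wfa d e \<Longrightarrow> wfa (Suc d) e"
  by (induction e) auto

lemma wf_F_adj [simp]: "d \<ge> 4 \<Longrightarrow> wfa d x \<Longrightarrow> wfa d y \<Longrightarrow> wf_fm (F_adj d x y) d"
  by (simp add: F_adj_def wfa_Suc)

text \<open>At most \<open>m\<close> steps are made. Since \<open>m\<close> is fixed by the program,
  \<open>F_walk\<close> can unroll this into nested quantifiers, and connectivity needs no graph
  search.\<close>

primrec walk :: "nat \<Rightarrow> ('a \<Rightarrow> 'a \<Rightarrow> bool) \<Rightarrow> 'a set \<Rightarrow> 'a \<Rightarrow> 'a \<Rightarrow> bool" where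
  "walk 0 E S x y \<longleftrightarrow> x = y"
| "walk (Suc m) E S x y \<longleftrightarrow> x = y \<or> (\<exists>z \<in> S. E x z \<and> walk m E S z y)"

primrec F_walk :: "nat \<Rightarrow> nat \<Rightarrow> nat \<Rightarrow> aexp \<Rightarrow> aexp \<Rightarrow> fm" where
  "F_walk 0 j d x y = F_eq x y"
| "F_walk (Suc m) j d x y = F_or (F_eq x y) (FEx (Reg 3) (FAnd (F_in (Reg d) j)
     (FAnd (F_adj (Suc d) x (Reg d)) (F_walk m j (Suc d) (Reg d) y))))"

lemma F_walk:
  assumes "graph_state n w \<sigma>" and "d \<ge> 4" and "wfa d x" and "wfa d y" and "j < d"
  shows "fval (F_walk m j d x y) d \<sigma> \<longleftrightarrow>
    walk m (bit_adj n w) {v. v < n \<and> 0 < snd \<sigma> j v} (aval x \<sigma>) (aval y \<sigma>)"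
  using assms
proof (induction m arbitrary: d \<sigma> x)
  case (Suc m)
  have n: "bound (Reg 3) \<sigma> = n" using Suc.prems(1) by (simp add: bound_def graph_state_def)
  have "fval (FAnd (F_in (Reg d) j) (FAnd (F_adj (Suc d) x (Reg d)) (F_walk m j (Suc d) (Reg d) y)))
      (Suc d) (set_reg d z \<sigma>) \<longleftrightarrow> 0 < snd \<sigma> j z \<and> bit_adj n w (aval x \<sigma>) z \<and>
      walk m (bit_adj n w) {v. v < n \<and> 0 < snd \<sigma> j v} z (aval y \<sigma>)" for z
    using Suc.prems
    by (simp add: F_adj[where n = n and w = w] Suc.IH[of "set_reg d z \<sigma>" "Suc d" "Reg d"]
        wfa_Suc aval_set_reg)
  then show ?case by (auto simp: n)
qed simp

lemma wf_F_walk [simp]: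
  "d \<ge> 4 \<Longrightarrow> wfa d x \<Longrightarrow> wfa d y \<Longrightarrow> j < d \<Longrightarrow> wf_fm (F_walk m j d x y) d"
  by (induction m arbitrary: d x) (auto simp: wfa_Suc)

text \<open>One step of the steered choice, with \<open>p (2 * i)\<close> and
  \<open>p (2 * i + 1)\<close> as the \<open>i\<close>-th pair of
  \<open>maximal_independent_pairs\<close> and \<open>f\<close> as the decisions made so far. The
  last exclusion never hits \<open>I\<close>, whose members below a steering vertex are not adjacent
  to its partner.\<close>

definition greedy :: "(nat \<Rightarrow> nat \<Rightarrow> bool) \<Rightarrow> nat \<Rightarrow> (nat \<Rightarrow> nat) \<Rightarrow> nat \<Rightarrow> (nat \<Rightarrow> nat) \<Rightarrow> bool" where
  "greedy E s p v f \<longleftrightarrow> (\<exists>i < s. v = p (2 * i)) \<or>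
     \<not> ((\<exists>i < s. E v (p (2 * i))) \<or> (\<exists>u < v. 0 < f u \<and> E v u) \<or>
        (\<exists>i < s. v < p (2 * i) \<and> E v (p (2 * i + 1))))"

text \<open>Register \<open>b + j\<close> holds entry \<open>j\<close> of the steering tuple,
  register \<open>d\<close> the vertex under decision, and array \<open>d\<close> the set chosen so
  far. The quantifier bounded by register \<open>d\<close> ranges over the smaller vertices.\<close>

definition F_greedy :: "nat \<Rightarrow> nat \<Rightarrow> nat \<Rightarrow> fm" where
  "F_greedy s b d = F_or (F_any s (\<lambda>i. F_eq (Reg d) (Reg (b + 2 * i))))
     (FNot (F_or (F_any s (\<lambda>i. F_adj (Suc d) (Reg d) (Reg (b + 2 * i))))
       (F_or (FEx (Reg d) (FAnd (F_in (Reg (Suc d)) d) (F_adj (Suc (Suc d)) (Reg d) (Reg (Suc d)))))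
         (F_any s (\<lambda>i. FAnd (FLess (Reg d) (Reg (b + 2 * i)))
           (F_adj (Suc d) (Reg d) (Reg (b + 2 * i + 1))))))))"

lemma F_greedy:
  assumes "graph_state n w \<sigma>" and "4 \<le> b" and "b + 2 * s \<le> d" and "\<And>i. i < 2 * s \<Longrightarrow> fst \<sigma> (b + i) = p i"
  shows "fval (FFill (Reg 3) (F_greedy s b d) \<psi>) d \<sigma> \<longleftrightarrow> fval \<psi> (Suc d)
    (set_arr d (fill (greedy (bit_adj n w) s p) n) (set_reg d 0 \<sigma>))"
proof -
  have n: "bound (Reg 3) \<sigma> = n" using assms(1) by (simp add: bound_def graph_state_def)
  have p: "fst \<sigma> (b + 2 * i) = p (2 * i)" "fst \<sigma> (Suc (b + 2 * i)) = p (2 * i + 1)"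
    "b + 2 * i < d" "Suc (b + 2 * i) < d" if "i < s" for i
    using assms(3) assms(4)[of "2 * i"] assms(4)[of "2 * i + 1"] that by auto
  have d: "4 \<le> d" using assms(2,3) by simp
  have "fill (\<lambda>v f. fval (F_greedy s b d) (Suc d) (set_reg d v (set_arr d f \<sigma>))) n =
    fill (greedy (bit_adj n w) s p) n"
  proof (rule fill_cong)
    fix v f assume v: "v < n"
    define \<tau> where "\<tau> = set_reg d v (set_arr d f \<sigma>)"
    have gs: "graph_state n w \<tau>" using assms(1) d by (simp add: \<tau>_def)
    have "bound (Reg d) \<tau> = v" using v assms(1) d by (simp add: \<tau>_def bound_def graph_state_def)
    moreover have \<tau>: "fst \<tau> d = v" "snd \<tau> d = f" by (simp_all add: \<tau>_def)
    moreover have \<tau>': "fst \<tau> (b + 2 * i) = p (2 * i)" "fst \<tau> (b + 2 * i + 1) = p (2 * i + 1)"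
      if "i < s" for i
      using p[OF that] by (simp_all add: \<tau>_def)
    moreover have "fval (F_adj (Suc d) (Reg d) (Reg (b + 2 * i))) (Suc d) \<tau> \<longleftrightarrow> bit_adj n w v (p (2 * i))"
      "fval (F_adj (Suc d) (Reg d) (Reg (b + 2 * i + 1))) (Suc d) \<tau> \<longleftrightarrow> bit_adj n w v (p (2 * i + 1))"
      if "i < s" for i
      using p[OF that] \<tau> \<tau>'[OF that] assms(2) d by (simp_all add: F_adj[OF gs])
    moreover have "fval (F_adj (Suc (Suc d)) (Reg d) (Reg (Suc d))) (Suc (Suc d)) (set_reg (Suc d) u \<tau>)
        \<longleftrightarrow> bit_adj n w v u" for u
      using gs d \<tau> by (subst F_adj[where n = n and w = w]) auto
    ultimately have "fval (F_greedy s b d) (Suc d) \<tau> \<longleftrightarrow> greedy (bit_adj n w) s p v f"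
      unfolding F_greedy_def greedy_def by (simp cong: conj_cong)
    then show "fval (F_greedy s b d) (Suc d) (set_reg d v (set_arr d f \<sigma>)) \<longleftrightarrow>
        greedy (bit_adj n w) s p v f"
      by (simp add: \<tau>_def)
  qed
  then show ?thesis by (simp add: n)
qed

lemma wf_F_greedy [simp]:
  "4 \<le> b \<Longrightarrow> b + 2 * s \<le> d \<Longrightarrow> wf_fm (F_greedy s b d) (Suc d)"
  by (auto simp: F_greedy_def)

text \<open>
  The tuple \<open>t\<close> consists of the pairs steering \<open>A\<close> (first \<open>2s\<close> entries, each \<open>v\<close> followed by its \<open>u\<close>),
  those steering \<open>B\<close>, and \<open>c\<close> extra members of the transversal. Entries need not be vertices:
  the tests are sound for every tuple.
\<close>

definition accept :: "(nat \<Rightarrow> nat \<Rightarrow> bool) \<Rightarrow> nat \<Rightarrow> nat \<Rightarrow> nat \<Rightarrow> bool \<Rightarrow> nat \<Rightarrow> (nat \<Rightarrow> nat) \<Rightarrow> bool" where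
  "accept E n s c conn k t \<longleftrightarrow>
     (let A = {v. v < n \<and> 0 < fill (greedy E s t) n v};
          B = {v. v < n \<and> 0 < fill (greedy E s (\<lambda>i. t (2 * s + i))) n v};
          S = {v. v < n \<and> (v \<notin> A \<and> v \<notin> B \<or> (\<exists>i < c. v = t (4 * s + i)))}
      in card S \<le> k \<and>
         (\<forall>x < n. \<forall>y < n. x \<notin> S \<longrightarrow> y \<notin> S \<longrightarrow> E x y \<longrightarrow> x \<in> A \<longleftrightarrow> y \<notin> A) \<and>
         (conn \<longrightarrow> (\<forall>x \<in> S. \<forall>y \<in> S. walk (3 * s) E S x y)))"

definition F_bipartite :: "nat \<Rightarrow> nat \<Rightarrow> nat \<Rightarrow> fm" where
  "F_bipartite a j d = FNot (FEx (Reg 3) (FEx (Reg 3) (FAnd (FNot (F_in (Reg d) j))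
     (FAnd (FNot (F_in (Reg (Suc d)) j)) (FAnd (F_adj (Suc (Suc d)) (Reg d) (Reg (Suc d)))
       (F_or (FAnd (F_in (Reg d) a) (F_in (Reg (Suc d)) a))
         (FAnd (FNot (F_in (Reg d) a)) (FNot (F_in (Reg (Suc d)) a)))))))))"

definition F_connected :: "nat \<Rightarrow> nat \<Rightarrow> nat \<Rightarrow> fm" where
  "F_connected m j d = FNot (FEx (Reg 3) (FEx (Reg 3) (FAnd (F_in (Reg d) j)
     (FAnd (F_in (Reg (Suc d)) j) (FNot (F_walk m j (Suc (Suc d)) (Reg d) (Reg (Suc d))))))))"

text \<open>Arrays \<open>d\<close>, \<open>d + 1\<close> and \<open>d + 2\<close> receive
  \<open>A\<close>, \<open>B\<close> and the candidate transversal, register \<open>d + 3\<close>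
  its size. The tuple occupies registers \<open>6\<close> to \<open>d - 1\<close>, and register
  \<open>5\<close> holds the size bound.\<close>

definition F_accept :: "nat \<Rightarrow> nat \<Rightarrow> bool \<Rightarrow> nat \<Rightarrow> fm" where
  "F_accept s c conn d =
     FFill (Reg 3) (F_greedy s 6 d)
     (FFill (Reg 3) (F_greedy s (6 + 2 * s) (d + 1))
     (FFill (Reg 3)
       (F_or (FAnd (FNot (F_in (Reg (d + 2)) d)) (FNot (F_in (Reg (d + 2)) (d + 1))))
         (F_any c (\<lambda>i. F_eq (Reg (d + 2)) (Reg (6 + 4 * s + i)))))
     (FIter (Reg 3) (Num 0) (Plus (Reg (d + 3)) (Get (d + 2) (Reg (d + 4))))
     (FAnd (FNot (FLess (Reg 5) (Reg (d + 3))))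
     (FAnd (F_bipartite d (d + 2) (d + 4))
       (if conn then F_connected (3 * s) (d + 2) (d + 4) else F_true))))))"

lemma bounded_not_ex:
  "\<not> (\<exists>x < n. \<exists>y < n. \<not> P x y) \<longleftrightarrow> (\<forall>x < (n :: nat). \<forall>y < n. P x y)"
  "\<not> (\<exists>x < n. \<exists>y < n. \<not> (Q x \<longrightarrow> Q y \<longrightarrow> P x y)) \<longleftrightarrow>
    (\<forall>x \<in> {v. v < (n :: nat) \<and> Q v}. \<forall>y \<in> {v. v < n \<and> Q v}. P x y)"
  by blast+

lemma F_bipartite:
  assumes "graph_state n w \<sigma>" and "4 \<le> d"
  shows "fval (F_bipartite a j d) d \<sigma> \<longleftrightarrow> (\<forall>x < n. \<forall>y < n. \<not> 0 < snd \<sigma> j x \<longrightarrow> \<not> 0 < snd \<sigma> j y \<longrightarrow>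
    bit_adj n w x y \<longrightarrow> 0 < snd \<sigma> a x \<longleftrightarrow> \<not> 0 < snd \<sigma> a y)"
proof -
  have n: "bound (Reg 3) \<sigma> = n" "bound (Reg 3) (set_reg d x \<sigma>) = n" for x
    using assms by (simp_all add: bound_def graph_state_def)
  have "fval (F_adj (Suc (Suc d)) (Reg d) (Reg (Suc d))) (Suc (Suc d)) (set_reg (Suc d) y (set_reg d x \<sigma>))
      \<longleftrightarrow> bit_adj n w x y" for x y
    using assms by (subst F_adj[where n = n and w = w]) auto
  then have "fval (FAnd (FNot (F_in (Reg d) j))
     (FAnd (FNot (F_in (Reg (Suc d)) j)) (FAnd (F_adj (Suc (Suc d)) (Reg d) (Reg (Suc d)))
       (F_or (FAnd (F_in (Reg d) a) (F_in (Reg (Suc d)) a))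
         (FAnd (FNot (F_in (Reg d) a)) (FNot (F_in (Reg (Suc d)) a)))))))
      (Suc (Suc d)) (set_reg (Suc d) y (set_reg d x \<sigma>)) \<longleftrightarrow>
      \<not> (\<not> 0 < snd \<sigma> j x \<longrightarrow> \<not> 0 < snd \<sigma> j y \<longrightarrow> bit_adj n w x y \<longrightarrow>
      0 < snd \<sigma> a x \<longleftrightarrow> \<not> 0 < snd \<sigma> a y)" for x y
    by auto
  then show ?thesis unfolding F_bipartite_def fval.simps(2,4) n by (simp only: bounded_not_ex(1))
qed

lemma F_connected:
  assumes "graph_state n w \<sigma>" and "4 \<le> d" and "j < d"
  shows "fval (F_connected m j d) d \<sigma> \<longleftrightarrow> (\<forall>x \<in> {v. v < n \<and> 0 < snd \<sigma> j v}. \<forall>y \<in> {v. v < n \<and> 0 < snd \<sigma> j v}.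
    walk m (bit_adj n w) {v. v < n \<and> 0 < snd \<sigma> j v} x y)"
proof -
  have n: "bound (Reg 3) \<sigma> = n" "bound (Reg 3) (set_reg d x \<sigma>) = n" for x
    using assms by (simp_all add: bound_def graph_state_def)
  have "fval (F_walk m j (Suc (Suc d)) (Reg d) (Reg (Suc d))) (Suc (Suc d)) (set_reg (Suc d) y (set_reg d x \<sigma>))
      \<longleftrightarrow> walk m (bit_adj n w) {v. v < n \<and> 0 < snd \<sigma> j v} x y" for x y
    using assms by (subst F_walk[where n = n and w = w]) auto
  then have "fval (FAnd (F_in (Reg d) j)
     (FAnd (F_in (Reg (Suc d)) j) (FNot (F_walk m j (Suc (Suc d)) (Reg d) (Reg (Suc d))))))
      (Suc (Suc d)) (set_reg (Suc d) y (set_reg d x \<sigma>)) \<longleftrightarrow>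
      \<not> (0 < snd \<sigma> j x \<longrightarrow> 0 < snd \<sigma> j y \<longrightarrow>
      walk m (bit_adj n w) {v. v < n \<and> 0 < snd \<sigma> j v} x y)" for x y
    by simp
  then show ?thesis unfolding F_connected_def fval.simps(2,4) n by (simp only: bounded_not_ex(2))
qed

lemma F_accept:
  assumes "graph_state n w \<sigma>" and d: "d = 6 + (4 * s + c)" and "fst \<sigma> 5 = k"
    and t: "\<And>i. i < 4 * s + c \<Longrightarrow> fst \<sigma> (6 + i) = t i"
  shows "fval (F_accept s c conn d) d \<sigma> \<longleftrightarrow> accept (bit_adj n w) n s c conn k t"
proof -
  let ?E = "bit_adj n w"
  let ?f = "fill (greedy ?E s t) n" and ?g = "fill (greedy ?E s (\<lambda>i. t (2 * s + i))) n"
  define P where "P v \<longleftrightarrow> \<not> 0 < ?f v \<and> \<not> 0 < ?g v \<or> (\<exists>i < c. v = t (4 * s + i))" for v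
  let ?h = "fill (\<lambda>v f. P v) n"
  let ?\<sigma>1 = "set_arr d ?f (set_reg d 0 \<sigma>)"
  let ?\<sigma>2 = "set_arr (d + 1) ?g (set_reg (d + 1) 0 ?\<sigma>1)"
  let ?\<sigma>3 = "set_arr (d + 2) ?h (set_reg (d + 2) 0 ?\<sigma>2)"
  let ?S = "{v. v < n \<and> P v}"
  let ?\<sigma>4 = "set_reg (d + 3) (card ?S) ?\<sigma>3"
  have gs: "graph_state n w ?\<sigma>1" "graph_state n w ?\<sigma>2" "graph_state n w ?\<sigma>3" "graph_state n w ?\<sigma>4"
    using assms(1) d by simp_all
  have n: "bound (Reg 3) \<tau> = n" if "graph_state n w \<tau>" for \<tau>
    using that by (simp add: bound_def graph_state_def)
  have h: "?h v = of_bool (P v)" if "v < n" for v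
    using fill_before[OF that, of "\<lambda>v f. P v"] by simp
  have third: "fill (\<lambda>v f. fval (F_or (FAnd (FNot (F_in (Reg (d + 2)) d)) (FNot (F_in (Reg (d + 2)) (d + 1))))
         (F_any c (\<lambda>i. F_eq (Reg (d + 2)) (Reg (6 + 4 * s + i))))) (Suc (d + 2))
         (set_reg (d + 2) v (set_arr (d + 2) f ?\<sigma>2))) n = ?h"
  proof (rule fill_cong)
    fix v f
    define \<tau> where "\<tau> = set_reg (d + 2) v (set_arr (d + 2) f ?\<sigma>2)"
    have "fst \<tau> (6 + 4 * s + i) = t (4 * s + i)" if "i < c" for i
      using t[of "4 * s + i"] that d by (simp add: \<tau>_def add.assoc)
    moreover have "fst \<tau> (d + 2) = v" "snd \<tau> d = ?f" "snd \<tau> (d + 1) = ?g" by (simp_all add: \<tau>_def)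
    ultimately have "fval (F_or (FAnd (FNot (F_in (Reg (d + 2)) d)) (FNot (F_in (Reg (d + 2)) (d + 1))))
         (F_any c (\<lambda>i. F_eq (Reg (d + 2)) (Reg (6 + 4 * s + i))))) (Suc (d + 2)) \<tau> \<longleftrightarrow> P v"
      unfolding P_def by (simp cong: conj_cong)
    then show "fval (F_or (FAnd (FNot (F_in (Reg (d + 2)) d)) (FNot (F_in (Reg (d + 2)) (d + 1))))
         (F_any c (\<lambda>i. F_eq (Reg (d + 2)) (Reg (6 + 4 * s + i))))) (Suc (d + 2))
         (set_reg (d + 2) v (set_arr (d + 2) f ?\<sigma>2)) \<longleftrightarrow> P v"
      by (simp only: \<tau>_def)
  qed
  have sum: "(\<Sum>v < n. ?h v) = card ?S"
    by (simp add: h sum.If_cases of_bool_def lessThan_def Int_def)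
  have cnt: "iterate (\<lambda>m x. aval (Plus (Reg (d + 3)) (Get (d + 2) (Reg (d + 4))))
      (set_reg (Suc (d + 3)) m (set_reg (d + 3) x ?\<sigma>3))) (aval (Num 0) ?\<sigma>3) n = card ?S"
    using sum by (simp add: iterate_sum)
  have S: "{v. v < n \<and> 0 < ?h v} = ?S" using h by auto
  have "fval (F_accept s c conn d) d \<sigma> \<longleftrightarrow> fval (FAnd (FNot (FLess (Reg 5) (Reg (d + 3))))
     (FAnd (F_bipartite d (d + 2) (d + 4))
       (if conn then F_connected (3 * s) (d + 2) (d + 4) else F_true))) (d + 4) ?\<sigma>4"
  proof -
    have 1: "fval (FFill (Reg 3) (F_greedy s 6 d) \<psi>) d \<sigma> \<longleftrightarrow> fval \<psi> (d + 1) ?\<sigma>1" for \<psi>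
      using t by (subst F_greedy[OF assms(1), where p = t]) (auto simp: d)
    have 2: "fval (FFill (Reg 3) (F_greedy s (6 + 2 * s) (d + 1)) \<psi>) (d + 1) ?\<sigma>1 \<longleftrightarrow> fval \<psi> (d + 2) ?\<sigma>2" for \<psi>
      using t by (subst F_greedy[OF gs(1), where p = "\<lambda>i. t (2 * s + i)"]) (auto simp: d add.assoc)
    have 3: "fval (FFill (Reg 3)
       (F_or (FAnd (FNot (F_in (Reg (d + 2)) d)) (FNot (F_in (Reg (d + 2)) (d + 1))))
         (F_any c (\<lambda>i. F_eq (Reg (d + 2)) (Reg (6 + 4 * s + i))))) \<psi>) (d + 2) ?\<sigma>2 \<longleftrightarrow> fval \<psi> (d + 3) ?\<sigma>3" for \<psi>
      unfolding fval.simps(5) n[OF gs(2)] third by (simp add: eval_nat_numeral)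
    have 4: "fval (FIter (Reg 3) (Num 0) (Plus (Reg (d + 3)) (Get (d + 2) (Reg (d + 4)))) \<psi>) (d + 3) ?\<sigma>3
      \<longleftrightarrow> fval \<psi> (d + 4) ?\<sigma>4" for \<psi>
      unfolding fval.simps(6) n[OF gs(3)] cnt by (simp add: eval_nat_numeral)
    show ?thesis unfolding F_accept_def 1 2 3 4 ..
  qed
  also have "\<dots> \<longleftrightarrow> card ?S \<le> k \<and>
      (\<forall>x < n. \<forall>y < n. \<not> 0 < ?h x \<longrightarrow> \<not> 0 < ?h y \<longrightarrow> ?E x y \<longrightarrow> 0 < ?f x \<longleftrightarrow> \<not> 0 < ?f y) \<and>
      (conn \<longrightarrow> (\<forall>x \<in> ?S. \<forall>y \<in> ?S. walk (3 * s) ?E ?S x y))"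
  proof -
    define \<tau> where "\<tau> = ?\<sigma>4"
    have \<tau>: "graph_state n w \<tau>" "fst \<tau> (d + 3) = card ?S" "fst \<tau> 5 = k" "snd \<tau> d = ?f" "snd \<tau> (d + 2) = ?h"
      using gs(4) assms(3) d unfolding \<tau>_def by simp_all
    have "4 \<le> d + 4" "d + 2 < d + 4" by simp_all
    note F_bipartite[OF \<tau>(1) this(1), of d "d + 2"] F_connected[OF \<tau>(1) this, of "3 * s"]
    then show ?thesis unfolding \<tau>_def[symmetric] using \<tau>(2-5)
      by (cases conn) (simp_all only: fval.simps aval.simps \<tau>(2-5) S not_less F_basic simp_thms if_True if_False)
  qed
  also have "\<dots> \<longleftrightarrow> card ?S \<le> k \<and>
      (\<forall>x < n. \<forall>y < n. x \<notin> ?S \<longrightarrow> y \<notin> ?S \<longrightarrow> ?E x y \<longrightarrow> x \<in> {v. v < n \<and> 0 < ?f v} \<longleftrightarrow> y \<notin> {v. v < n \<and> 0 < ?f v}) \<and>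
      (conn \<longrightarrow> (\<forall>x \<in> ?S. \<forall>y \<in> ?S. walk (3 * s) ?E ?S x y))"
    using h by (simp cong: imp_cong)
  also have "\<dots> \<longleftrightarrow> accept ?E n s c conn k t"
  proof -
    have "{v. v < n \<and> (v \<notin> {v. v < n \<and> 0 < ?f v} \<and> v \<notin> {v. v < n \<and> 0 < ?g v} \<or>
      (\<exists>i < c. v = t (4 * s + i)))} = ?S"
      unfolding P_def by auto
    then show ?thesis unfolding accept_def Let_def by (simp only:)
  qed
  finally show ?thesis .
qed

lemma wf_F_accept:
  assumes "d = 6 + (4 * s + c)"
  shows "wf_fm (F_accept s c conn d) d"
  using assms by (auto simp: F_accept_def F_bipartite_def F_connected_def eval_nat_numeral)


section \<open>Soundness and completeness of the acceptance test\<close>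

lemma walk_reachable: "walk m E S x y \<Longrightarrow> x \<in> S \<Longrightarrow> (x, y) \<in> (edges_in E S)\<^sup>*"
proof (induction m arbitrary: x)
  case (Suc m)
  show ?case
  proof (cases "x = y")
    case False
    then obtain z where "z \<in> S" "E x z" "walk m E S z y" using Suc.prems(1) by auto
    with Suc show ?thesis
      by (intro converse_rtrancl_into_rtrancl[of x z]) (auto simp: edges_in_def)
  qed simp
qed simp

lemma relpow_walk: "(x, y) \<in> edges_in E S ^^ j \<Longrightarrow> j \<le> m \<Longrightarrow> walk m E S x y"
proof (induction m arbitrary: x j)
  case (Suc m)
  show ?case
  proof (cases j)
    case (Suc i)
    with Suc.prems(1) obtain z where "(x, z) \<in> edges_in E S" "(z, y) \<in> edges_in E S ^^ i"
      using relpow_Suc_D2 by metis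
    with Suc.IH[of z i] Suc Suc.prems(2) show ?thesis by (auto simp: edges_in_def)
  qed (use Suc.prems in simp)
qed simp

lemma accept_sound:
  assumes "accept E n s c conn k t"
  shows "\<exists>S. transversal E {..<n} S \<and> (conn \<longrightarrow> connected_in E S) \<and> card S \<le> k"
proof -
  define A where "A = {v. v < n \<and> 0 < fill (greedy E s t) n v}"
  define B where "B = {v. v < n \<and> 0 < fill (greedy E s (\<lambda>i. t (2 * s + i))) n v}"
  define S where "S = {v. v < n \<and> (v \<notin> A \<and> v \<notin> B \<or> (\<exists>i < c. v = t (4 * s + i)))}"
  have S: "card S \<le> k" "\<And>x y. x < n \<Longrightarrow> y < n \<Longrightarrow> x \<notin> S \<Longrightarrow> y \<notin> S \<Longrightarrow> E x y \<Longrightarrow> x \<in> A \<longleftrightarrow> y \<notin> A"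
    "conn \<Longrightarrow> \<forall>x \<in> S. \<forall>y \<in> S. walk (3 * s) E S x y"
    using assms unfolding accept_def Let_def A_def[symmetric] B_def[symmetric] S_def[symmetric] by blast+
  have "transversal E {..<n} S"
    unfolding transversal_def
  proof (intro conjI exI[of _ "\<lambda>x. x \<in> A"] ballI impI)
    show "S \<subseteq> {..<n}" by (auto simp: S_def)
    fix x y assume "x \<in> {..<n} - S" "y \<in> {..<n} - S" "E x y"
    then show "(x \<in> A) \<noteq> (y \<in> A)" using S(2)[of x y] by simp
  qed
  moreover have "connected_in E S" if conn
    unfolding connected_in_def using S(3)[OF that] walk_reachable by fast
  ultimately show ?thesis using S(1) by blast
qed

text \<open>The outcome of \<open>maximal_independent_pairs\<close>, with the list stretched to
  exactly \<open>s\<close> pairs and flattened into one function: \<open>v\<close> at even and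
  \<open>u\<close> at odd places.\<close>

definition decodes :: "(nat \<Rightarrow> nat \<Rightarrow> bool) \<Rightarrow> nat \<Rightarrow> nat \<Rightarrow> (nat \<Rightarrow> nat) \<Rightarrow> nat set \<Rightarrow> bool" where
  "decodes E n s p I \<longleftrightarrow> (\<forall>i < s. p (2 * i) \<in> I) \<and>
     (\<forall>i < s. \<forall>x \<in> I. x < p (2 * i) \<longrightarrow> \<not> E x (p (2 * i + 1))) \<and>
     (\<forall>x < n. x \<notin> I \<longrightarrow> (\<exists>w \<in> I. w < x \<and> E x w) \<or>
       (\<exists>i < s. E x (p (2 * i)) \<or> x < p (2 * i) \<and> E x (p (2 * i + 1))))"

text \<open>By induction, the array already describes \<open>I\<close> below \<open>v\<close>. A
  member of \<open>I\<close> meets none of the exclusions in \<open>greedy\<close>; for a non-member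
  the last clause of \<open>decodes\<close> supplies one.\<close>

lemma fill_greedy:
  assumes "decodes E n s p I" and "I \<subseteq> {..<n}" and "independent E I" and "v < n"
  shows "0 < fill (greedy E s p) n v \<longleftrightarrow> v \<in> I"
  using assms(4)
proof (induction v rule: less_induct)
  case (less v)
  let ?f = "fill (greedy E s p)"
  \<comment> \<open>A cell never changes once it has been written.\<close>
  have "?f v u = ?f n u" if "u < v" for u
    using fill_before[of u v] fill_before[of u n] that less.prems by simp
  then have f: "0 < ?f v u \<longleftrightarrow> u \<in> I" if "u < v" for u
    using less.IH[OF that] less.prems that by simp
  have nE: "\<not> E x y" if "x \<in> I" "y \<in> I" for x y
    using assms(3) that by (auto simp: independent_def)
  have D: "p (2 * i) \<in> I" "x \<in> I \<Longrightarrow> x < p (2 * i) \<Longrightarrow> \<not> E x (p (2 * i + 1))" if "i < s" for i x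
    using assms(1) that unfolding decodes_def by blast+
  have "greedy E s p v (?f v) \<longleftrightarrow> v \<in> I"
  proof
    assume g: "greedy E s p v (?f v)"
    show "v \<in> I"
    proof (rule ccontr)
      assume "v \<notin> I"
      then consider w where "w \<in> I" "w < v" "E v w"
        | i where "i < s" "E v (p (2 * i)) \<or> v < p (2 * i) \<and> E v (p (2 * i + 1))"
        using assms(1) less.prems unfolding decodes_def by blast
      then show False
      proof cases
        case 1
        then show False using g f[of w] D(1) \<open>v \<notin> I\<close> unfolding greedy_def by blast
      next
        case 2
        then show False using g D(1) \<open>v \<notin> I\<close> unfolding greedy_def by blast
      qed
    qed
  next
    assume v: "v \<in> I"
    have "\<not> E v (p (2 * i))" if "i < s" for i using nE[OF v] D(1)[OF that] by blast
    moreover have "\<not> (0 < ?f v u \<and> E v u)" if "u < v" for u using f[OF that] nE[OF v] by blast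
    moreover have "\<not> (v < p (2 * i) \<and> E v (p (2 * i + 1)))" if "i < s" for i using D(2)[OF that v] by blast
    ultimately show "greedy E s p v (?f v)" unfolding greedy_def by blast
  qed
  then show ?case using fill_before[OF less.prems, of "greedy E s p"] by simp
qed

lemma ex_decodes:
  assumes "symp E" and "matching_free E s {..<n}" and "1 \<le> s" and "0 < n"
    and I: "maximal_independent E {..<n} I"
  shows "\<exists>p. (\<forall>i. p i < n) \<and> decodes E n s p I"
proof -
  have In: "I \<subseteq> {..<n}" using I by (simp add: maximal_independent_def)
  have "matching_free E (Suc (s - 1)) {..<n}" using assms(2,3) by simp
  from maximal_independent_pairs[OF assms(1) finite_lessThan this I] obtain ps where
    ps: "length ps \<le> s - 1"
    "\<forall>(v, u) \<in> set ps. v \<in> I \<and> u \<in> {..<n} \<and> (\<forall>x \<in> I. x < v \<longrightarrow> \<not> E x u)"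
    "\<forall>x \<in> {..<n} - I. (\<exists>w \<in> I. w < x \<and> E x w) \<or> (\<exists>(v, u) \<in> set ps. E x v \<or> x < v \<and> E x u)"
    by (elim exE conjE)
  show ?thesis
  proof (cases "ps = []")
    case True
    then have *: "\<exists>w \<in> I. w < x \<and> E x w" if "x < n" "x \<notin> I" for x using ps(3) that by simp
    \<comment> \<open>Without departures \<open>I\<close> contains vertex 0, and
      \<open>(0, 0)\<close> is harmless padding: it excludes only neighbours of a member of
      \<open>I\<close>, and no vertex lies below 0.\<close>
    then have "0 \<in> I" using assms(4) by blast
    then show ?thesis using * assms(4) by (intro exI[of _ "\<lambda>_. 0"]) (simp add: decodes_def)
  next
    case False
    \<comment> \<open>Repeating the last pair stretches the list to length \<open>s\<close> without
      adding conditions.\<close>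
    define q where "q i = ps ! min i (length ps - 1)" for i
    define p where "p j = (if even j then fst (q (j div 2)) else snd (q (j div 2)))" for j
    have p: "p (2 * i) = fst (q i)" "p (2 * i + 1) = snd (q i)" for i by (simp_all add: p_def)
    have q: "q i \<in> set ps" for i
    proof -
      have "min i (length ps - 1) < length ps" using False by (cases ps) auto
      then show ?thesis unfolding q_def by (rule nth_mem)
    qed
    have qI: "fst (q i) \<in> I" "snd (q i) < n" "x \<in> I \<Longrightarrow> x < fst (q i) \<Longrightarrow> \<not> E x (snd (q i))" for i x
      using ps(2) q[of i] by (auto simp: case_prod_beta)
    have "p j < n" for j using qI(1,2)[of "j div 2"] In by (auto simp: p_def)
    moreover have "decodes E n s p I"
      unfolding decodes_def p
    proof (intro conjI allI impI ballI)
      fix x assume "x < n" "x \<notin> I"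
      with bspec[OF ps(3), of x] have "(\<exists>w \<in> I. w < x \<and> E x w) \<or>
        (\<exists>r \<in> set ps. E x (fst r) \<or> x < fst r \<and> E x (snd r))"
        by (simp add: case_prod_beta)
      then consider "\<exists>w \<in> I. w < x \<and> E x w"
        | r where "r \<in> set ps" "E x (fst r) \<or> x < fst r \<and> E x (snd r)"
        by blast
      then show "(\<exists>w \<in> I. w < x \<and> E x w) \<or>
        (\<exists>i < s. E x (fst (q i)) \<or> x < fst (q i) \<and> E x (snd (q i)))"
      proof cases
        case 2
        then obtain i where i: "i < length ps" "r = ps ! i" by (auto simp: in_set_conv_nth)
        then have "i < s" "q i = r" using ps(1) by (auto simp: q_def)
        then show ?thesis using 2(2) by blast
      qed blast
    qed (use qI in auto)
    ultimately show ?thesis by blast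
  qed
qed

lemma accept_complete:
  assumes "symp E" and "\<And>x. \<not> E x x" and "matching_free E s {..<n}" and "1 \<le> s" and "n < L"
    and S: "transversal E {..<n} S" "conn \<longrightarrow> connected_in E S" "card S \<le> k"
  shows "\<exists>t. (\<forall>i < 4 * s + connector_bound s. t i < L) \<and> accept E n s (connector_bound s) conn k t"
proof (cases "n = 0")
  case True
  then show ?thesis using assms(5) by (intro exI[of _ "\<lambda>_. 0"]) (simp add: accept_def)
next
  case False
  let ?V = "{..<n}" and ?c = "connector_bound s"
  have "\<exists>A B D. maximal_independent E ?V A \<and> maximal_independent E ?V B \<and> D \<subseteq> ?V \<and> card D \<le> ?c \<and>
    (conn \<longrightarrow> connected_in E (?V - (A \<union> B) \<union> D)) \<and> card (?V - (A \<union> B) \<union> D) \<le> k"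
  proof (cases conn)
    case True
    then show ?thesis
      using connected_transversal_reduce[OF finite_lessThan assms(1-3) S(1)] S(2,3) order_trans by blast
  next
    case False
    obtain A B where AB: "maximal_independent E ?V A" "maximal_independent E ?V B" "?V - (A \<union> B) \<subseteq> S"
      using transversal_reduce[OF finite_lessThan assms(1,2) S(1)] by blast
    have "finite S" using S(1) by (auto simp: transversal_def intro: finite_subset)
    then have "card (?V - (A \<union> B)) \<le> k" using card_mono[OF _ AB(3)] S(3) by simp
    then show ?thesis using AB(1,2) False by (intro exI[of _ A] exI[of _ B] exI[of _ "{}"]) simp
  qed
  then obtain A B D where AB: "maximal_independent E ?V A" "maximal_independent E ?V B"
    and D: "D \<subseteq> ?V" "card D \<le> ?c"
    and SD: "conn \<Longrightarrow> connected_in E (?V - (A \<union> B) \<union> D)" "card (?V - (A \<union> B) \<union> D) \<le> k"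
    by blast
  have n: "0 < n" using False by simp
  obtain p q where p: "\<forall>i. p i < n" "decodes E n s p A" and q: "\<forall>i. q i < n" "decodes E n s q B"
    using ex_decodes[OF assms(1,3,4) n AB(1)] ex_decodes[OF assms(1,3,4) n AB(2)] by blast
  define l where "l = sorted_list_of_set D"
  have "finite D" using D(1) by (rule finite_subset) simp
  then have l: "set l = D" "length l \<le> ?c" using D(2) by (simp_all add: l_def)
  define t where "t i = (if i < 2 * s then p i else if i < 4 * s then q (i - 2 * s)
    else if i - 4 * s < length l then l ! (i - 4 * s) else n)" for i
  have "t i < L" for i
  proof -
    have "l ! j < n" if "j < length l" for j using D(1) l(1) nth_mem[OF that] by auto
    then show ?thesis using p(1) q(1) assms(5) by (auto simp: t_def intro: less_trans)
  qed
  moreover have "accept E n s ?c conn k t"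
  proof -
    \<comment> \<open>\<open>greedy\<close> reads only the first \<open>2 * s\<close> entries, where
      the tuples coincide.\<close>
    have "greedy E s t = greedy E s p" "greedy E s (\<lambda>i. t (2 * s + i)) = greedy E s q"
      by (auto simp: fun_eq_iff greedy_def t_def cong: conj_cong)
    then have A: "{v. v < n \<and> 0 < fill (greedy E s t) n v} = A"
      and B: "{v. v < n \<and> 0 < fill (greedy E s (\<lambda>i. t (2 * s + i))) n v} = B"
      using fill_greedy[OF p(2)] fill_greedy[OF q(2)] AB
      by (auto simp: maximal_independent_def)
    have "(\<exists>i < ?c. v = t (4 * s + i)) \<longleftrightarrow> v \<in> D" if "v < n" for v
      using that l by (auto simp: t_def in_set_conv_nth intro: less_le_trans)
    then have S': "{v. v < n \<and> (v \<notin> A \<and> v \<notin> B \<or> (\<exists>i < ?c. v = t (4 * s + i)))} = ?V - (A \<union> B) \<union> D"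
      using D(1) by auto
    have "x \<in> A \<longleftrightarrow> y \<notin> A" if "x < n" "y < n" "x \<notin> ?V - (A \<union> B) \<union> D" "y \<notin> ?V - (A \<union> B) \<union> D" "E x y" for x y
      using that AB unfolding maximal_independent_def independent_def by blast
    moreover have "walk (3 * s) E (?V - (A \<union> B) \<union> D) x y"
      if "conn" "x \<in> ?V - (A \<union> B) \<union> D" "y \<in> ?V - (A \<union> B) \<union> D" for x y
    proof -
      have "(x, y) \<in> (edges_in E (?V - (A \<union> B) \<union> D))\<^sup>*"
        using SD(1) that unfolding connected_in_def by blast
      moreover have "matching_free E s (?V - (A \<union> B) \<union> D)"
        using D(1) by (intro matching_free_mono[OF assms(3)]) auto
      ultimately show ?thesis
        using matching_free_walk[OF assms(1)] relpow_walk by (metis less_imp_le)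
    qed
    ultimately show ?thesis unfolding accept_def Let_def A B S' using SD(2) by blast
  qed
  ultimately show ?thesis by blast
qed


section \<open>Reading the input\<close>

lemma binary_nth: "j < length (binary m) \<Longrightarrow> binary m ! j \<longleftrightarrow> odd (m div 2 ^ j)"
proof (induction m arbitrary: j rule: binary.induct)
  case (1 n)
  show ?case
  proof (cases "n = 0")
    case True
    then show ?thesis using 1(2) by (simp add: binary.simps[of 0])
  next
    case False
    then have b: "binary n = odd n # binary (n div 2)" by (subst binary.simps) simp
    show ?thesis
    proof (cases j)
      case (Suc i)
      then show ?thesis using 1(1)[OF False, of i] 1(2) by (simp add: b div_mult2_eq)
    qed (simp add: b)
  qed
qed

lemma less_pow_length_binary: "m < 2 ^ length (binary m)"
proof (induction m rule: binary.induct)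
  case (1 n)
  show ?case
  proof (cases "n = 0")
    case False
    then have b: "binary n = odd n # binary (n div 2)" by (subst binary.simps) simp
    show ?thesis using 1[OF False] by (simp add: b)
  qed simp
qed

text \<open>Horner's scheme. The least significant bit comes first in the list, which is therefore
  read backwards; after \<open>i\<close> rounds the accumulator holds the top \<open>i\<close>
  bits.\<close>

lemma iterate_binary:
  assumes "i \<le> length (binary m)"
  shows "iterate (\<lambda>i x. x + x + of_bool (binary m ! (length (binary m) - 1 - i))) 0 i =
    m div 2 ^ (length (binary m) - i)"
  using assms
proof (induction i)
  case 0
  then show ?case using less_pow_length_binary[of m] by simp
next
  case (Suc i)
  let ?l = "length (binary m)"
  define j where "j = ?l - Suc i"
  have j: "?l - i = Suc j" "?l - 1 - i = j" "j < ?l" using Suc.prems by (auto simp: j_def)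
  have half: "m div 2 ^ Suc j = (m div 2 ^ j) div 2"
    by (simp add: div_mult2_eq[symmetric] mult.commute)
  have "q div 2 + q div 2 + of_bool (odd q) = q" for q :: nat
    by (cases "even q") (auto elim!: evenE oddE)
  then have "m div 2 ^ Suc j + m div 2 ^ Suc j + of_bool (odd (m div 2 ^ j)) = m div 2 ^ j"
    unfolding half .
  then show ?case using Suc binary_nth[OF j(3)] by (simp add: j j_def[symmetric])
qed

lemma nth_concat_rows:
  assumes "\<And>xs. xs \<in> set xss \<Longrightarrow> length xs = n" and "i < length xss" and "j < n"
  shows "concat xss ! (i * n + j) = xss ! i ! j"
  using assms
proof (induction xss arbitrary: i)
  case (Cons xs xss)
  then show ?case by (cases i) (auto simp: nth_append)
qed simp

lemma length_encode: "length (encode (G, k)) =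
  order_of G + 1 + order_of G * order_of G + 1 + length (binary (nat \<bar>k\<bar>))"
  by (simp add: encode_def Let_def order_of_def length_concat comp_def sum_list_triv)

lemma nth_encode:
  shows "i < order_of G \<Longrightarrow> encode (G, k) ! i"
    and "\<not> encode (G, k) ! order_of G"
    and "x < order_of G \<Longrightarrow> y < order_of G \<Longrightarrow>
      encode (G, k) ! (order_of G + 1 + x * order_of G + y) \<longleftrightarrow> (vertex G x, vertex G y) \<in> parcs G"
    and "encode (G, k) ! (order_of G + 1 + order_of G * order_of G) \<longleftrightarrow> k < 0"
    and "encode (G, k) ! (order_of G + 1 + order_of G * order_of G + 1 + j) = binary (nat \<bar>k\<bar>) ! j"
proof -
  let ?n = "order_of G"
  define vs where "vs = sorted_list_of_set (pverts G)"
  define rows where "rows = map (\<lambda>u. map (\<lambda>v. (u, v) \<in> parcs G) vs) vs"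
  have n: "length vs = ?n" by (simp add: vs_def order_of_def)
  have enc: "encode (G, k) = replicate ?n True @ False # concat rows @ (k < 0) # binary (nat \<bar>k\<bar>)"
    by (simp add: encode_def Let_def rows_def vs_def order_of_def)
  have len: "length (concat rows) = ?n * ?n"
    by (simp add: rows_def length_concat comp_def sum_list_triv n)
  show "i < ?n \<Longrightarrow> encode (G, k) ! i" by (simp add: enc nth_append)
  show "\<not> encode (G, k) ! ?n" by (simp add: enc nth_append)
  show "encode (G, k) ! (?n + 1 + ?n * ?n) \<longleftrightarrow> k < 0"
    by (simp add: enc nth_append len)
  show "encode (G, k) ! (?n + 1 + ?n * ?n + 1 + j) = binary (nat \<bar>k\<bar>) ! j"
    by (simp add: enc nth_append len)
  assume xy: "x < ?n" "y < ?n"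
  have "x * ?n + y < ?n * ?n"
  proof -
    have "x * ?n + y < Suc x * ?n" using xy by simp
    also have "\<dots> \<le> ?n * ?n" using xy(1) by (intro mult_le_mono1) simp
    finally show ?thesis .
  qed
  then have "encode (G, k) ! (?n + 1 + x * ?n + y) = concat rows ! (x * ?n + y)"
    by (simp add: enc nth_append len)
  also have "\<dots> = rows ! x ! y"
    by (rule nth_concat_rows) (use xy n in \<open>auto simp: rows_def\<close>)
  also have "\<dots> = ((vertex G x, vertex G y) \<in> parcs G)"
    using xy n by (simp add: rows_def vertex_def vs_def)
  finally show "encode (G, k) ! (?n + 1 + x * ?n + y) \<longleftrightarrow> (vertex G x, vertex G y) \<in> parcs G" .
qed

text \<open>
  Array \<open>2\<close> marks the leading ones of the input; registers \<open>3\<close>, \<open>4\<close> and \<open>5\<close> hold the number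
  \<open>n\<close> of vertices, the position \<open>n + 1 + n * n\<close> of the sign bit, and \<open>\<bar>k\<bar>\<close>.
\<close>

definition F_main :: "nat \<Rightarrow> bool \<Rightarrow> fm" where
  "F_main s conn =
     FFill (Reg 0) (FNot (FEx (Plus (Reg 2) (Num 1)) (FNot (F_in (Reg 3) 0))))
     (FIter (Reg 0) (Num 0) (Plus (Reg 3) (Get 2 (Reg 4)))
     (FIter (Reg 3) (Plus (Reg 3) (Num 1)) (Plus (Reg 4) (Reg 3))
     (FIter (Minus (Minus (Reg 0) (Reg 4)) (Num 1)) (Num 0)
       (Plus (Plus (Reg 5) (Reg 5)) (Get 0 (Minus (Minus (Reg 0) (Num 1)) (Reg 6))))
     (FAnd (FNot (F_in (Reg 4) 0))
       (F_tuple (4 * s + connector_bound s)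
         (F_accept s (connector_bound s) conn (6 + (4 * s + connector_bound s))))))))"

lemma wf_F_main: "wf_fm (F_main s conn) 2"
  using wf_F_accept[OF refl, of s "connector_bound s" conn] by (simp add: F_main_def eval_nat_numeral)

lemma iterate_cong:
  assumes "\<And>i x. i < m \<Longrightarrow> f i x = g i x"
  shows "iterate f a m = iterate g a m"
  using assms by (induction m) auto

lemma F_main:
  "fval (F_main s conn) 2 (init_state (encode (G, k))) \<longleftrightarrow> 0 \<le> k \<and>
     (\<exists>t. (\<forall>i < 4 * s + connector_bound s. t i < length (encode (G, k))) \<and>
       accept (adj G) (order_of G) s (connector_bound s) conn (nat \<bar>k\<bar>) t)"
proof -
  define w where "w = encode (G, k)"
  define b where "b = binary (nat \<bar>k\<bar>)"
  define \<sigma>0 where "\<sigma>0 = init_state w"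
  let ?L = "length w" and ?n = "order_of G" and ?K = "nat \<bar>k\<bar>" and ?c = "connector_bound s"
  let ?p = "?n + 1 + ?n * ?n"
  have L: "?L = ?p + 1 + length b" by (simp add: w_def b_def length_encode)
  have \<sigma>0: "fst \<sigma>0 0 = ?L" "\<And>i. i < ?L \<Longrightarrow> snd \<sigma>0 0 i = of_bool (w ! i)"
    by (simp_all add: \<sigma>0_def init_state_def)
  have nL: "?n < ?L" using L by simp
  have Suc_num: "Suc 3 = 4" "Suc 4 = 5" "Suc 5 = 6" by simp_all
  let ?f = "fill (\<lambda>v f. v < ?n) ?L"
  define \<sigma>1 where "\<sigma>1 = set_arr 2 ?f (set_reg 2 0 \<sigma>0)"
  define \<sigma>2 where "\<sigma>2 = set_reg 3 ?n \<sigma>1"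
  define \<sigma>3 where "\<sigma>3 = set_reg 4 ?p \<sigma>2"
  define \<sigma>4 where "\<sigma>4 = set_reg 5 ?K \<sigma>3"
  have "fill (\<lambda>v f. fval (FNot (FEx (Plus (Reg 2) (Num 1)) (FNot (F_in (Reg 3) 0)))) 3
      (set_reg 2 v (set_arr 2 f \<sigma>0))) ?L = ?f"
  proof (rule fill_cong)
    fix v f assume v: "v < ?L"
    \<comment> \<open>The terminating \<open>False\<close> sits at position \<open>n\<close>, so
      exactly the positions below \<open>n\<close> have an all-true prefix. The bound
      \<open>v + 1\<close> in the formula makes the prefix include \<open>v\<close>.\<close>
    have "(\<forall>i \<le> v. w ! i) \<longleftrightarrow> v < ?n"
    proof
      assume "\<forall>i \<le> v. w ! i"
      then show "v < ?n" using nth_encode(2)[where G = G and k = k] by (auto simp: w_def not_less[symmetric])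
    qed (use nth_encode(1)[where G = G and k = k] in \<open>auto simp: w_def\<close>)
    then show "fval (FNot (FEx (Plus (Reg 2) (Num 1)) (FNot (F_in (Reg 3) 0)))) 3
      (set_reg 2 v (set_arr 2 f \<sigma>0)) \<longleftrightarrow> v < ?n"
      using v \<sigma>0 by (auto simp: bound_def less_Suc_eq_le)
  qed
  then have 1: "fval (FFill (Reg 0) (FNot (FEx (Plus (Reg 2) (Num 1)) (FNot (F_in (Reg 3) 0)))) \<psi>) 2 \<sigma>0
      \<longleftrightarrow> fval \<psi> 3 \<sigma>1" for \<psi>
    by (simp add: \<sigma>1_def bound_def \<sigma>0(1) eval_nat_numeral)
  have \<sigma>1: "fst \<sigma>1 0 = ?L" "snd \<sigma>1 0 = snd \<sigma>0 0" "snd \<sigma>1 2 = ?f" by (simp_all add: \<sigma>1_def \<sigma>0)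
  have "(\<Sum>v < ?L. ?f v) = card {v. v < ?L \<and> v < ?n}"
    by (simp add: fill_before of_bool_def sum.If_cases lessThan_def Int_def)
  also have "{v. v < ?L \<and> v < ?n} = {..<?n}" using nL by auto
  finally have "(\<Sum>v < ?L. ?f v) = ?n" by simp
  then have "iterate (\<lambda>m x. aval (Plus (Reg 3) (Get 2 (Reg 4))) (set_reg (Suc 3) m (set_reg 3 x \<sigma>1)))
      (aval (Num 0) \<sigma>1) (bound (Reg 0) \<sigma>1) = ?n"
    using \<sigma>1 by (simp add: bound_def iterate_sum)
  then have 2: "fval (FIter (Reg 0) (Num 0) (Plus (Reg 3) (Get 2 (Reg 4))) \<psi>) 3 \<sigma>1 \<longleftrightarrow> fval \<psi> 4 \<sigma>2" for \<psi>
    unfolding fval.simps(6) \<sigma>2_def by (simp only: Suc_num)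
  have \<sigma>2: "fst \<sigma>2 0 = ?L" "snd \<sigma>2 0 = snd \<sigma>0 0" "fst \<sigma>2 3 = ?n" by (simp_all add: \<sigma>2_def \<sigma>1)
  have "iterate (\<lambda>m x. aval (Plus (Reg 4) (Reg 3)) (set_reg (Suc 4) m (set_reg 4 x \<sigma>2)))
      (aval (Plus (Reg 3) (Num 1)) \<sigma>2) (bound (Reg 3) \<sigma>2) = ?p"
    using \<sigma>2 nL by (simp add: bound_def iterate_add)
  then have 3: "fval (FIter (Reg 3) (Plus (Reg 3) (Num 1)) (Plus (Reg 4) (Reg 3)) \<psi>) 4 \<sigma>2 \<longleftrightarrow> fval \<psi> 5 \<sigma>3" for \<psi>
    unfolding fval.simps(6) \<sigma>3_def by (simp only: Suc_num)
  have \<sigma>3: "fst \<sigma>3 0 = ?L" "snd \<sigma>3 0 = snd \<sigma>0 0" "fst \<sigma>3 3 = ?n" "fst \<sigma>3 4 = ?p"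
    by (simp_all add: \<sigma>3_def \<sigma>2)
  have "iterate (\<lambda>m x. aval (Plus (Plus (Reg 5) (Reg 5)) (Get 0 (Minus (Minus (Reg 0) (Num 1)) (Reg 6))))
      (set_reg (Suc 5) m (set_reg 5 x \<sigma>3))) 0 (length b) =
      iterate (\<lambda>i x. x + x + of_bool (b ! (length b - 1 - i))) 0 (length b)"
  proof (rule iterate_cong)
    fix i x assume i: "i < length b"
    \<comment> \<open>The binary part ends the input, so counting back from the last cell meets the
      most significant bit first.\<close>
    have "?L - 1 - i = ?p + 1 + (length b - 1 - i)" using L i by simp
    then have "w ! (?L - 1 - i) = b ! (length b - 1 - i)"
      unfolding w_def b_def using nth_encode(5)[of G k] by simp
    then show "aval (Plus (Plus (Reg 5) (Reg 5)) (Get 0 (Minus (Minus (Reg 0) (Num 1)) (Reg 6))))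
      (set_reg (Suc 5) i (set_reg 5 x \<sigma>3)) = x + x + of_bool (b ! (length b - 1 - i))"
      using \<sigma>3 \<sigma>0(2)[of "?L - 1 - i"] L by simp
  qed
  also have "\<dots> = ?K" using iterate_binary[of "length b" ?K] by (simp add: b_def)
  finally have "iterate (\<lambda>m x. aval (Plus (Plus (Reg 5) (Reg 5)) (Get 0 (Minus (Minus (Reg 0) (Num 1)) (Reg 6))))
      (set_reg (Suc 5) m (set_reg 5 x \<sigma>3))) (aval (Num 0) \<sigma>3)
      (bound (Minus (Minus (Reg 0) (Reg 4)) (Num 1)) \<sigma>3) = ?K"
    using \<sigma>3 L by (simp add: bound_def)
  then have 4: "fval (FIter (Minus (Minus (Reg 0) (Reg 4)) (Num 1)) (Num 0)
       (Plus (Plus (Reg 5) (Reg 5)) (Get 0 (Minus (Minus (Reg 0) (Num 1)) (Reg 6)))) \<psi>) 5 \<sigma>3 \<longleftrightarrow> fval \<psi> 6 \<sigma>4" for \<psi>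
    unfolding fval.simps(6) \<sigma>4_def by (simp only: Suc_num)
  have \<sigma>4: "fst \<sigma>4 0 = ?L" "snd \<sigma>4 0 = snd \<sigma>0 0" "fst \<sigma>4 3 = ?n" "fst \<sigma>4 4 = ?p" "fst \<sigma>4 5 = ?K"
    by (simp_all add: \<sigma>4_def \<sigma>3)
  have sign: "fval (FNot (F_in (Reg 4) 0)) 6 \<sigma>4 \<longleftrightarrow> 0 \<le> k"
    using nth_encode(4)[of G k] \<sigma>0(2)[of ?p] L by (auto simp: \<sigma>4 w_def)
  have adj: "bit_adj ?n (snd \<sigma>0 0) = adj G"
  proof (intro ext)
    fix x y
    show "bit_adj ?n (snd \<sigma>0 0) x y = adj G x y"
    proof (cases "x < ?n \<and> y < ?n")
      case True
      then have "x * ?n + y < Suc x * ?n" by simp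
      also have "\<dots> \<le> ?n * ?n" using True by (intro mult_le_mono1) simp
      finally have "?n + 1 + x * ?n + y < ?L" using L by simp
      then show ?thesis using True \<sigma>0(2) nth_encode(3)[where G = G and k = k and x = x and y = y]
        by (simp add: bit_adj_def adj_def w_def)
    qed (auto simp: bit_adj_def adj_def)
  qed
  have "graph_state ?n (snd \<sigma>0 0) \<sigma>4" using \<sigma>4 nL by (simp add: graph_state_def)
  then have "fval (F_accept s ?c conn (6 + (4 * s + ?c))) (6 + (4 * s + ?c)) (set_regs 6 (4 * s + ?c) t \<sigma>4)
      \<longleftrightarrow> accept (adj G) ?n s ?c conn ?K t" for t
    unfolding adj[symmetric] by (intro F_accept) (use \<sigma>4(5) in \<open>auto simp: set_regs_def graph_state_def\<close>)
  then have "fval (F_tuple (4 * s + ?c) (F_accept s ?c conn (6 + (4 * s + ?c)))) 6 \<sigma>4 \<longleftrightarrow>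
      (\<exists>t. (\<forall>i < 4 * s + ?c. t i < ?L) \<and> accept (adj G) ?n s ?c conn ?K t)"
    by (simp add: F_tuple \<sigma>4)
  then show ?thesis
    unfolding F_main_def w_def[symmetric] \<sigma>0_def[symmetric] 1 2 3 4 fval.simps(3) sign by (simp only:)
qed

lemma F_main_correct:
  assumes "(G, k) \<in> free_instances (disjoint_copies s (path_graph 2))" and "1 \<le> s"
  shows "fval (F_main s conn) 2 (init_state (encode (G, k))) \<longleftrightarrow>
    (\<exists>S. transversal (adj G) {..<order_of G} S \<and> (conn \<longrightarrow> connected_in (adj G) S) \<and> int (card S) \<le> k)"
proof -
  have G: "pair_graph G" and free: "matching_free (adj G) s {..<order_of G}"
    using assms(1) matching_free_adj by (auto simp: free_instances_def)
  have n: "order_of G < length (encode (G, k))" by (simp add: length_encode)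
  show ?thesis
  proof (cases "0 \<le> k")
    case True
    then have k: "int m \<le> k \<longleftrightarrow> m \<le> nat \<bar>k\<bar>" for m by linarith
    show ?thesis unfolding F_main k
      using accept_sound accept_complete[OF adj_symp[OF G] adj_irrefl[OF G] free assms(2) n] True
      by blast
  next
    case False
    then have "\<not> int m \<le> k" for m by linarith
    then show ?thesis using False by (simp add: F_main)
  qed
qed

theorem theorem15:
  fixes s :: nat
  assumes "s \<ge> 1"
  shows "solvable_in_poly_time encode (free_instances (disjoint_copies s (path_graph 2)))
           odd_cycle_transversal_problem
       \<and> solvable_in_poly_time encode (free_instances (disjoint_copies s (path_graph 2)))
           connected_odd_cycle_transversal_problem"
proof
  let ?D = "free_instances (disjoint_copies s (path_graph 2))"
  have G: "pair_graph G" if "(G, k) \<in> ?D" for G k using that by (simp add: free_instances_def)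
  show "solvable_in_poly_time encode ?D odd_cycle_transversal_problem"
  proof (rule solvable_in_poly_time_fm[OF wf_F_main])
    fix x assume x: "x \<in> ?D"
    obtain G k where Gk: "x = (G, k)" by (cases x)
    show "fval (F_main s False) 2 (init_state (encode x)) \<longleftrightarrow> x \<in> odd_cycle_transversal_problem"
      using x F_main_correct[of G k s False] odd_cycle_transversal_adj[OF G] assms by (simp add: Gk)
  qed
  show "solvable_in_poly_time encode ?D connected_odd_cycle_transversal_problem"
  proof (rule solvable_in_poly_time_fm[OF wf_F_main])
    fix x assume x: "x \<in> ?D"
    obtain G k where Gk: "x = (G, k)" by (cases x)
    show "fval (F_main s True) 2 (init_state (encode x)) \<longleftrightarrow> x \<in> connected_odd_cycle_transversal_problem"
      using x F_main_correct[of G k s True] connected_odd_cycle_transversal_adj[OF G] assms by (simp add: Gk)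
  qed
qed

end
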